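(* Let $\mathcal{A}$ be a stably finite simple unital $C^*$-algebra. For every nonzero $x\in M(\mathcal{A})$ and $n\in\mathbb{N}$ put $$s_n(x)=\sup \{s\in \mathbb{N} \mid s\langle 1\rangle_{\mathrm{C}}\preceq_{\mathrm{C}} n\langle x\rangle_{\mathrm{C}}\},\qquad r_n(x)=\inf \{r\in \mathbb{N} \mid r\langle 1\rangle_{\mathrm{C}}\succeq_{\mathrm{C}} n\langle x\rangle_{\mathrm{C}}\},$$ and let $A_-(x)=\lim_{n\to \infty} s_n(x)/n$ and $A_+(x)=\lim_{n\to \infty} r_n(x)/n$ (these limits exist). Then $$[A_-(x), A_+(x)]= \{\varphi(x) \mid \varphi \text{ is a dimension function for } \mathcal{A}\}$$ for every nonzero $x\in M(\mathcal{A})$.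
   Context: $\mathbb{N}=\{1,2,\dots\}$; $\sup\emptyset$ is taken to be $0$ in the definition of $s_n(x)$ (this concerns only finitely many $n$). A unital ring is stably finite if for all $n\in\mathbb{N}$ and $n\times n$ matrices $A,B$ over it, $AB=I_n$ implies $BA=I_n$. $M(\mathcal{A})$ is the set of all rectangular matrices over $\mathcal{A}$; $\mathrm{diag}(A,B)$ is the block diagonal matrix. Cuntz semigroup: for $A,B\in M(\mathcal{A})$, $A\preceq_{\mathrm{C}}B$ means there are sequences $\{C_n\},\{D_n\}$ in $M(\mathcal{A})$ with $C_nBD_n\to A$ in norm; $A\sim_{\mathrm{C}}B$ if $A\preceq_{\mathrm{C}}B$ and $B\preceq_{\mathrm{C}}A$. $\mathrm{W}_{\mathrm{C}}(\mathcal{A})=M(\mathcal{A})/\sim_{\mathrm{C}}$ with classes $\langle A\rangle_{\mathrm{C}}$ is an abelian monoid under $\langle A\rangle_{\mathrm{C}}+\langle B\rangle_{\mathrm{C}}=\langle\mathrm{diag}(A,B)\rangle_{\mathrm{C}}$, partially ordered by $\langle A\rangle_{\mathrm{C}}\preceq_{\mathrm{C}}\langle B\rangle_{\mathrm{C}}$ iff $A\preceq_{\mathrm{C}}B$. A dimension function for $\mathcal{A}$ is a function $\varphi:M(\mathcal{A})\to\mathbb{R}_{\ge0}$ such that $\varphi(A)\le\varphi(B)$ whenever $A\preceq_{\mathrm{C}}B$, $\varphi(1)=1$, and $\varphi(\mathrm{diag}(A,B))=\varphi(A)+\varphi(B)$. *)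

theory Defs
  imports Complex_Main "Jordan_Normal_Form.Matrix"
begin

text \<open>Unital complex \<open>C\<^sup>*\<close>-algebras. The superclasses make the algebra a real Banach algebra with
  \<open>norm 1 = 1\<close>; in particular it is nonzero.\<close>

class unital_cstar_algebra = real_normed_algebra_1 + banach +
  fixes scaleC :: "complex \<Rightarrow> 'a \<Rightarrow> 'a"
    and cstar :: "'a \<Rightarrow> 'a"
  assumes scaleC_add_right: "scaleC c (x + y) = scaleC c x + scaleC c y"
    and scaleC_add_left: "scaleC (c + d) x = scaleC c x + scaleC d x"
    and scaleC_scaleC: "scaleC c (scaleC d x) = scaleC (c * d) x"
    and scaleC_of_real: "scaleC (complex_of_real r) x = scaleR r x"
    and mult_scaleC_left: "scaleC c x * y = scaleC c (x * y)"
    and mult_scaleC_right: "x * scaleC c y = scaleC c (x * y)"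
    and norm_scaleC: "norm (scaleC c x) = cmod c * norm x"
    and cstar_cstar: "cstar (cstar x) = x"
    and cstar_add: "cstar (x + y) = cstar x + cstar y"
    and cstar_scaleC: "cstar (scaleC c x) = scaleC (cnj c) (cstar x)"
    and cstar_mult: "cstar (x * y) = cstar y * cstar x"
    and cstar_identity: "norm (cstar x * x) = norm x ^ 2"

definition stably_finite :: "'a::ring_1 itself \<Rightarrow> bool" where
  "stably_finite _ \<longleftrightarrow>
     (\<forall>n\<ge>1. \<forall>A \<in> carrier_mat n n. \<forall>B \<in> carrier_mat n n.
        A * B = (1\<^sub>m n :: 'a mat) \<longrightarrow> B * A = 1\<^sub>m n)"

text \<open>Closure under scalars and negation is automatic, since the algebra is unital.\<close>

definition closed_two_sided_ideal :: "'a::unital_cstar_algebra set \<Rightarrow> bool" where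
  "closed_two_sided_ideal I \<longleftrightarrow>
     closed I \<and> 0 \<in> I \<and> (\<forall>x\<in>I. \<forall>y\<in>I. x + y \<in> I) \<and>
     (\<forall>a. \<forall>x\<in>I. a * x \<in> I \<and> x * a \<in> I)"

definition simple_cstar_algebra :: "'a::unital_cstar_algebra itself \<Rightarrow> bool" where
  "simple_cstar_algebra _ \<longleftrightarrow>
     (\<forall>I :: 'a set. closed_two_sided_ideal I \<longrightarrow> I = {0} \<or> I = UNIV)"

text \<open>Matrices with at least one row and one column; the type \<open>mat\<close> also contains the
  degenerate ones.\<close>

definition rect_mats :: "'a mat set" where
  "rect_mats = {A. 1 \<le> dim_row A \<and> 1 \<le> dim_col A}"

definition block_diag :: "'a::zero mat \<Rightarrow> 'a mat \<Rightarrow> 'a mat" where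
  "block_diag A B =
     four_block_mat A (0\<^sub>m (dim_row A) (dim_col B)) (0\<^sub>m (dim_row B) (dim_col A)) B"

text \<open>The \<open>C\<^sup>*\<close>-norm of an \<open>m \<times> n\<close> matrix is its operator norm as a map between the right Hilbert
  modules of columns of length \<open>n\<close> and \<open>m\<close>, with inner product \<open>\<Sum>i. cstar (u i) * v i\<close>.\<close>

definition column_norm :: "'a::unital_cstar_algebra vec \<Rightarrow> real" where
  "column_norm v = sqrt (norm (\<Sum>i<dim_vec v. cstar (v $ i) * v $ i))"

definition mat_norm :: "'a::unital_cstar_algebra mat \<Rightarrow> real" where
  "mat_norm A = Sup {column_norm (A *\<^sub>v v) | v. v \<in> carrier_vec (dim_col A) \<and> column_norm v \<le> 1}"

definition cuntz_le :: "'a::unital_cstar_algebra mat \<Rightarrow> 'a mat \<Rightarrow> bool" where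
  "cuntz_le A B \<longleftrightarrow>
     (\<exists>C D. (\<forall>k. C k \<in> carrier_mat (dim_row A) (dim_row B)) \<and>
            (\<forall>k. D k \<in> carrier_mat (dim_col B) (dim_col A)) \<and>
            (\<lambda>k::nat. mat_norm (C k * B * D k - A)) \<longlonglongrightarrow> 0)"

definition cuntz_rel :: "('a::unital_cstar_algebra mat \<times> 'a mat) set" where
  "cuntz_rel = {(A, B). A \<in> rect_mats \<and> B \<in> rect_mats \<and> cuntz_le A B \<and> cuntz_le B A}"

text \<open>The Cuntz semigroup is \<open>rect_mats // cuntz_rel\<close>; its operations are given on
  equivalence classes, through representatives.\<close>

definition cuntz_class :: "'a::unital_cstar_algebra mat \<Rightarrow> 'a mat set" where
  "cuntz_class A = cuntz_rel `` {A}"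

definition cuntz_class_le :: "'a::unital_cstar_algebra mat set \<Rightarrow> 'a mat set \<Rightarrow> bool" where
  "cuntz_class_le X Y \<longleftrightarrow> (\<exists>A\<in>X. \<exists>B\<in>Y. cuntz_le A B)"

definition cuntz_plus ::
    "'a::unital_cstar_algebra mat set \<Rightarrow> 'a mat set \<Rightarrow> 'a mat set" where
  "cuntz_plus X Y = (\<Union>A\<in>X. \<Union>B\<in>Y. cuntz_class (block_diag A B))"

primrec cuntz_multiple :: "nat \<Rightarrow> 'a::unital_cstar_algebra mat set \<Rightarrow> 'a mat set" where
  "cuntz_multiple 0 X = cuntz_class (0\<^sub>m 1 1)"
| "cuntz_multiple (Suc n) X = cuntz_plus (cuntz_multiple n X) X"

text \<open>On \<open>nat\<close> the supremum of the empty set is 0. For \<open>n \<ge> 1\<close> and nonzero \<open>x\<close> over a stably finite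
  simple algebra the first set is finite and the second one nonempty.\<close>

definition lower_count :: "nat \<Rightarrow> 'a::unital_cstar_algebra mat \<Rightarrow> nat" where
  "lower_count n x =
     Sup {s. 1 \<le> s \<and> cuntz_class_le (cuntz_multiple s (cuntz_class (1\<^sub>m 1)))
                                     (cuntz_multiple n (cuntz_class x))}"

definition upper_count :: "nat \<Rightarrow> 'a::unital_cstar_algebra mat \<Rightarrow> nat" where
  "upper_count n x =
     Inf {r. 1 \<le> r \<and> cuntz_class_le (cuntz_multiple n (cuntz_class x))
                                     (cuntz_multiple r (cuntz_class (1\<^sub>m 1)))}"

definition A_minus :: "'a::unital_cstar_algebra mat \<Rightarrow> real" where
  "A_minus x = lim (\<lambda>n. real (lower_count n x) / real n)"

definition A_plus :: "'a::unital_cstar_algebra mat \<Rightarrow> real" where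
  "A_plus x = lim (\<lambda>n. real (upper_count n x) / real n)"

text \<open>Only the values on \<open>rect_mats\<close> are constrained.\<close>

definition dimension_function :: "('a::unital_cstar_algebra mat \<Rightarrow> real) \<Rightarrow> bool" where
  "dimension_function \<phi> \<longleftrightarrow>
     (\<forall>A\<in>rect_mats. 0 \<le> \<phi> A) \<and>
     (\<forall>A\<in>rect_mats. \<forall>B\<in>rect_mats. cuntz_le A B \<longrightarrow> \<phi> A \<le> \<phi> B) \<and>
     \<phi> (1\<^sub>m 1) = 1 \<and>
     (\<forall>A\<in>rect_mats. \<forall>B\<in>rect_mats. \<phi> (block_diag A B) = \<phi> A + \<phi> B)"

end

theory Submission
  imports Defs
begin

text \<open>The Cuntz semigroup is a positively ordered abelian monoid with order unit \<open>\<langle>1\<rangle>\<close>, and its states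
  are the dimension functions. Simplicity makes \<open>\<langle>x\<rangle>\<close> an order unit as well, and stable
  finiteness makes the multiples of \<open>\<langle>1\<rangle>\<close> strictly increasing. For \<open>\<alpha>\<close> between the two limits,
  the assignment \<open>\<langle>1\<rangle> \<mapsto> 1\<close>, \<open>\<langle>x\<rangle> \<mapsto> \<alpha>\<close> respects all inequalities between combinations of
  \<open>\<langle>1\<rangle>\<close> and \<open>\<langle>x\<rangle>\<close>. A Hahn-Banach argument extends it to a state: among the monotone sublinear
  functionals with the prescribed behaviour on translations by \<open>\<langle>1\<rangle>\<close> and \<open>\<langle>x\<rangle>\<close>, a minimal one
  is additive.

  Convergence of matrices in operator norm amounts to convergence of the entries. This rests on
  \<open>\<parallel>a\<parallel> \<le> 2 \<parallel>a + b\<parallel>\<close> for positive \<open>a\<close>, \<open>b\<close> and on positivity of \<open>a\<^sup>* a\<close>, both of which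
  follow from the existence of square roots, without spectral theory.\<close>

section \<open>Positive elements\<close>

text \<open>Two obstacles shape the proof. The order on the Cuntz semigroup need not be
  cancellative: from \<open>z + v \<le> z + w\<close> one keeps only
  \<open>M v \<le> M w + R u\<close> for all \<open>M\<close>, where \<open>u\<close> is the class
  of 1 and \<open>R\<close> does not depend on \<open>M\<close>. This weak form suffices, because
  the two counts matter only through their growth rates, and dividing by \<open>M\<close> removes
  the error. For the same reason the extension argument works with functionals on the monoid itself
  and never forms differences. The other obstacle is that \<open>cuntz_le\<close> is an approximate
  relation, while stable finiteness speaks of exact equations. The two meet at identity matrices: an
  error smaller than 1 there can be removed by inverting a matrix close to the identity. Positivity
  is needed because a column norm controls the single entries only if nothing cancels in the sum of
  the products \<open>cstar (v $ i) * v $ i\<close>. One inclusion is elementary: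
  \<open>lower_count n x\<close> and \<open>upper_count n x\<close> bracket \<open>n\<close> times
  the value of any dimension function at \<open>x\<close>.\<close>

lemma scaleC_diff_right: "scaleC c (x - y) = scaleC c x - scaleC c (y :: 'a::unital_cstar_algebra)"
  using scaleC_add_right[of c "x - y" y] by simp

lemma scaleC_one: "scaleC 1 x = (x :: 'a::unital_cstar_algebra)"
  using scaleC_of_real[of 1 x] by simp

lemma scaleC_minus_left: "scaleC (- c) x = - scaleC c (x :: 'a::unital_cstar_algebra)"
  using scaleC_scaleC[of "-1" c x] scaleC_of_real[of "-1" "scaleC c x"] by simp

lemma cstar_zero [simp]: "cstar (0 :: 'a::unital_cstar_algebra) = 0"
  using cstar_add[of 0 0] by simp

lemma cstar_minus: "cstar (- x) = - cstar (x :: 'a::unital_cstar_algebra)"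
  using cstar_add[of x "- x"] by (simp add: eq_neg_iff_add_eq_0 add.commute)

lemma cstar_diff: "cstar (x - y) = cstar x - cstar (y :: 'a::unital_cstar_algebra)"
  using cstar_add[of x "- y"] by (simp add: cstar_minus)

lemma cstar_one [simp]: "cstar (1 :: 'a::unital_cstar_algebra) = 1"
  by (metis cstar_cstar cstar_mult mult_1_left mult_1_right)

lemma cstar_scaleR: "cstar (r *\<^sub>R x) = r *\<^sub>R cstar (x :: 'a::unital_cstar_algebra)"
  by (metis cstar_scaleC complex_cnj_complex_of_real scaleC_of_real)

lemma cstar_of_real [simp]: "cstar (of_real r :: 'a::unital_cstar_algebra) = of_real r"
  by (simp add: of_real_def cstar_scaleR)

lemma cstar_power: "cstar (x ^ n) = cstar (x :: 'a::unital_cstar_algebra) ^ n"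
  by (induction n) (simp_all add: cstar_mult power_commutes)

lemma norm_cstar [simp]: "norm (cstar x) = norm (x :: 'a::unital_cstar_algebra)"
proof -
  have le: "norm y \<le> norm (cstar y)" for y :: 'a
  proof (cases "y = 0")
    case False
    have "norm y * norm y \<le> norm (cstar y) * norm y"
      using cstar_identity[of y] norm_mult_ineq[of "cstar y" y] by (simp add: power2_eq_square)
    then show ?thesis using False by simp
  qed simp
  show ?thesis using le[of x] le[of "cstar x"] by (simp add: cstar_cstar)
qed

lemma norm_square_selfadjoint:
  "cstar x = x \<Longrightarrow> norm (x * x) = norm x ^ 2" for x :: "'a::unital_cstar_algebra"
  using cstar_identity[of x] by simp

lemma tendsto_cstar:
  assumes "f \<longlonglongrightarrow> (x :: 'a::unital_cstar_algebra)"
  shows "(\<lambda>n. cstar (f n)) \<longlonglongrightarrow> cstar x"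
  using assms unfolding tendsto_iff dist_norm by (simp flip: cstar_diff)

text \<open>The iteration \<open>y\<^sub>n\<^sub>+\<^sub>1 = (x + y\<^sub>n\<^sup>2) / 2\<close> converges to \<open>1 - sqrt (1 - x)\<close> and
  is dominated by the corresponding scalar iteration for \<open>x = 1\<close>.\<close>

lemma square_root_one_minus:
  fixes x :: "'a::unital_cstar_algebra"
  assumes sa: "cstar x = x" and nx: "norm x \<le> 1"
  obtains s where "cstar s = s" "s * s = 1 - x" "norm (1 - s) \<le> 1"
    "\<And>z. z * x = x * z \<Longrightarrow> z * s = s * z"
proof -
  define y :: "nat \<Rightarrow> 'a" where "y = rec_nat 0 (\<lambda>_ y. (1/2) *\<^sub>R (x + y * y))"
  define r :: "nat \<Rightarrow> real" where "r = rec_nat 0 (\<lambda>_ r. (1/2) * (1 + r * r))"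
  have y0: "y 0 = 0" and yS: "y (Suc n) = (1/2) *\<^sub>R (x + y n * y n)" for n
    by (simp_all add: y_def)
  have r0: "r 0 = 0" and rS: "r (Suc n) = (1/2) * (1 + r n * r n)" for n
    by (simp_all add: r_def)
  have r: "0 \<le> r n \<and> r n \<le> 1" for n
  proof (induction n)
    case (Suc n)
    then have "r n * r n \<le> 1" by (simp add: mult_le_one)
    then show ?case using Suc by (simp add: rS)
  qed (simp add: r0)
  have com: "z * y n = y n * z" if "z * x = x * z" for z n
  proof (induction n)
    case (Suc n)
    have "z * (y n * y n) = (y n * y n) * z" by (metis Suc mult.assoc)
    then show ?case using that by (simp add: yS algebra_simps)
  qed (simp add: y0)
  have sa_y: "cstar (y n) = y n" for n
    by (induction n) (simp_all add: y0 yS cstar_scaleR cstar_add cstar_mult sa)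
  have ny: "norm (y n) \<le> r n" for n
  proof (induction n)
    case (Suc n)
    have "norm (y n * y n) \<le> r n * r n"
      by (rule order_trans[OF norm_mult_ineq]) (use Suc r in \<open>simp add: mult_mono\<close>)
    then have "norm (x + y n * y n) \<le> 1 + r n * r n"
      using nx norm_triangle_ineq[of x "y n * y n"] by linarith
    then show ?case by (simp add: yS rS)
  qed (simp add: y0 r0)
  have diff: "norm (y (Suc n) - y n) \<le> r (Suc n) - r n" for n
  proof (induction n)
    case 0 then show ?case using nx by (simp add: y0 r0 yS rS)
  next
    case (Suc n)
    \<comment> \<open>Both iterates are polynomials in \<open>x\<close>. Once they commute, the
      difference of their squares factors, and the scalar iteration \<open>r\<close> satisfies the
      same identity.\<close>
    have c: "y (Suc n) * y n = y n * y (Suc n)"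
      by (rule com) (rule com[OF refl, symmetric])
    have "y (Suc (Suc n)) - y (Suc n) =
        (1/2) *\<^sub>R (y (Suc n) * y (Suc n)) - (1/2) *\<^sub>R (y n * y n)"
      by (simp only: yS[of "Suc n"] yS[of n] scaleR_add_right) simp
    also have "\<dots> = (1/2) *\<^sub>R ((y (Suc n) - y n) * (y (Suc n) + y n))"
      using c by (simp add: algebra_simps)
    finally have e: "y (Suc (Suc n)) - y (Suc n) = \<dots>" .
    have "norm ((y (Suc n) - y n) * (y (Suc n) + y n)) \<le>
        (r (Suc n) - r n) * (r (Suc n) + r n)"
    proof (rule order_trans[OF norm_mult_ineq], rule mult_mono)
      show "norm (y (Suc n) + y n) \<le> r (Suc n) + r n"
        using ny[of n] ny[of "Suc n"] norm_triangle_ineq[of "y (Suc n)" "y n"] by linarith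
      show "0 \<le> r (Suc n) - r n" using Suc norm_ge_zero order_trans by blast
    qed (use Suc in auto)
    moreover have "r (Suc (Suc n)) - r (Suc n) = (1/2) * ((r (Suc n) - r n) * (r (Suc n) + r n))"
      by (simp only: rS[of "Suc n"] rS[of n]) (simp add: algebra_simps)
    ultimately show ?case by (simp add: e)
  qed
  have r_mono: "r n \<le> r (Suc n)" for n
    using diff[of n] norm_ge_zero[of "y (Suc n) - y n"] by linarith
  then have "incseq r" by (simp add: incseq_SucI)
  then obtain L where "r \<longlonglongrightarrow> L"
    using incseq_convergent[of r 1] r by blast
  then have "summable (\<lambda>n. r (Suc n) - r n)"
    using telescope_summable by blast
  then have "summable (\<lambda>n. y (Suc n) - y n)"
    by (rule summable_comparison_test[rotated]) (use diff in auto)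
  then have "(\<lambda>n. \<Sum>k<n. y (Suc k) - y k) \<longlonglongrightarrow> suminf (\<lambda>n. y (Suc n) - y n)"
    by (simp add: summable_LIMSEQ)
  moreover have "(\<Sum>k<n. y (Suc k) - y k) = y n" for n
    by (simp add: sum_lessThan_telescope y0)
  ultimately obtain w where w: "y \<longlonglongrightarrow> w" by auto
  have "(\<lambda>n. y (Suc n)) \<longlonglongrightarrow> (1/2) *\<^sub>R (x + w * w)"
    unfolding yS by (intro tendsto_intros w)
  then have fix_w: "w = (1/2) *\<^sub>R (x + w * w)"
    using LIMSEQ_unique w LIMSEQ_Suc by blast
  then have "w + w = x + w * w"
    by (metis scaleR_2 scaleR_scaleR divide_self_if mult.commute scaleR_one times_divide_eq_right
        mult_1_left zero_neq_numeral mult.right_neutral)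
  then have ww: "(1 - w) * (1 - w) = 1 - x"
    by (simp add: algebra_simps)
  have cw: "cstar w = w"
    using tendsto_cstar[OF w] w LIMSEQ_unique unfolding sa_y by blast
  have nw: "norm w \<le> 1"
    by (rule LIMSEQ_le_const2[OF tendsto_norm[OF w]]) (meson ny r order_trans)
  have zw: "z * w = w * z" if "z * x = x * z" for z
  proof -
    have "(\<lambda>n. z * y n) \<longlonglongrightarrow> z * w" "(\<lambda>n. y n * z) \<longlonglongrightarrow> w * z"
      by (intro tendsto_intros w)+
    then show ?thesis unfolding com[OF that] using LIMSEQ_unique by blast
  qed
  show thesis
  proof (rule that)
    show "(1 - w) * (1 - w) = 1 - x" by (rule ww)
    show "cstar (1 - w) = 1 - w" by (simp add: cstar_diff cw)
    show "norm (1 - (1 - w)) \<le> 1" using nw by simp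
    show "z * (1 - w) = (1 - w) * z" if "z * x = x * z" for z
      using zw[OF that] by (simp add: right_diff_distrib left_diff_distrib)
  qed
qed

text \<open>With \<open>s\<close> a root of \<open>1 - k * k\<close> commuting with
  \<open>k\<close>, the element \<open>u = k + i s\<close> is unitary in the sense that
  \<open>cstar u * u = 1\<close>. So \<open>u\<close> has norm 1, its imaginary part
  \<open>s\<close> has norm at most 1, and \<open>1 - k * k\<close> is the square of
  \<open>s\<close>. This takes the place of a spectral estimate.\<close>

lemma norm_one_minus_square:
  fixes k :: "'a::unital_cstar_algebra"
  assumes sa: "cstar k = k" and nk: "norm k \<le> 1"
  shows "norm (1 - k * k) \<le> 1"
proof -
  have "norm (k * k) \<le> 1" using norm_mult_ineq[of k k] nk mult_le_one[of "norm k" "norm k"] by simp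
  then obtain s where s: "cstar s = s" "s * s = 1 - k * k"
      and com: "\<And>z. z * (k * k) = (k * k) * z \<Longrightarrow> z * s = s * z"
    using square_root_one_minus[of "k * k"] sa by (metis cstar_mult)
  have ks: "k * s = s * k" using com[of k] by (simp add: mult.assoc)
  define u where "u = k + scaleC \<i> s"
  have us: "cstar u = k - scaleC \<i> s"
    unfolding u_def cstar_add cstar_scaleC s sa
    by (simp add: scaleC_minus_left)
  have ii: "scaleC \<i> (scaleC \<i> (s * s)) = - (s * s)"
    unfolding scaleC_scaleC using scaleC_of_real[of "-1" "s * s"] by simp
  have "cstar u * u = k * k + s * s"
    unfolding us unfolding u_def
    by (simp add: distrib_left left_diff_distrib mult_scaleC_left mult_scaleC_right scaleC_diff_right ks ii)
  then have "norm u ^ 2 = 1" using cstar_identity[of u] by (simp add: s)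
  then have nu: "norm u = 1" by (simp add: power2_eq_1_iff) (metis abs_norm_cancel abs_1 abs_minus)
  have "scaleC \<i> (2 *\<^sub>R s) = u - cstar u"
    unfolding us unfolding u_def by (simp add: scaleR_2 scaleC_add_right)
  then have "norm (2 *\<^sub>R s) = norm (u - cstar u)"
    using norm_scaleC[of \<i> "2 *\<^sub>R s"] by simp
  also have "\<dots> \<le> 2" using norm_triangle_ineq4[of u "cstar u"] nu by simp
  finally have "norm s \<le> 1" by simp
  then have "norm (s * s) \<le> 1"
    using norm_mult_ineq[of s s] mult_le_one[of "norm s" "norm s"] by simp
  then show ?thesis by (simp add: s)
qed

section \<open>The cone of positive elements\<close>

text \<open>A square root comes with the definition. The equivalent description, self-adjoint with
  \<open>norm (of_real t - h) \<le> t\<close> for some \<open>t\<close>, is linear in nature and is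
  used wherever sums occur; \<open>norm_scalar_minus_positive\<close> and \<open>positiveI\<close>
  pass between the two.\<close>

definition positive :: "'a::unital_cstar_algebra \<Rightarrow> bool" where
  "positive h \<longleftrightarrow> (\<exists>k. cstar k = k \<and> k * k = h)"

lemma positive_selfadjoint: "positive h \<Longrightarrow> cstar h = h"
  by (auto simp: positive_def cstar_mult)

lemma positive_square: "cstar k = k \<Longrightarrow> positive (k * k)"
  by (auto simp: positive_def)

lemma norm_scalar_minus_positive:
  fixes h :: "'a::unital_cstar_algebra"
  assumes "positive h" "norm h \<le> t"
  shows "norm (of_real t - h) \<le> t"
proof (cases "t = 0")
  case False
  then have t: "t > 0" using assms(2) norm_ge_zero[of h] by linarith
  obtain k where k: "cstar k = k" "k * k = h" using assms(1) by (auto simp: positive_def)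
  define l where "l = (1 / sqrt t) *\<^sub>R k"
  have ll: "l * l = (1 / t) *\<^sub>R h" using t by (simp add: l_def k)
  have sa: "cstar l = l" by (simp add: l_def cstar_scaleR k)
  have "norm l ^ 2 \<le> 1"
    using t assms(2) norm_square_selfadjoint[OF sa] by (simp add: ll field_simps)
  then have "norm l \<le> 1" by (simp add: power_le_one_iff abs_square_le_1)
  then have *: "norm (1 - l * l) \<le> 1" by (rule norm_one_minus_square[OF sa])
  have "of_real t - h = t *\<^sub>R (1 - l * l)" using t by (simp add: ll of_real_def scaleR_right_diff_distrib)
  then show ?thesis using * t by simp
qed (use assms in simp)

text \<open>Scaling \<open>h\<close> to \<open>1 - x\<close> with \<open>norm x \<le> 1\<close>
  reduces this to \<open>square_root_one_minus\<close>. The bound on \<open>k\<close> has the form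
  of the assumption on \<open>h\<close>, so the root is again positive and a further root can be
  taken.\<close>

lemma positive_root:
  fixes h :: "'a::unital_cstar_algebra"
  assumes sa: "cstar h = h" and n: "norm (of_real t - h) \<le> t"
  obtains k where "cstar k = k" "k * k = h" "norm (of_real (sqrt t) - k) \<le> sqrt t"
    "\<And>z. z * h = h * z \<Longrightarrow> z * k = k * z"
proof (cases "t = 0")
  case True
  then have "h = 0" using n by simp
  then show thesis using that[of 0] True by simp
next
  case False
  then have t: "t > 0" using n norm_ge_zero[of "of_real t - h"] by linarith
  define x where "x = 1 - (1 / t) *\<^sub>R h"
  have "x = (1 / t) *\<^sub>R (of_real t - h)" using t by (simp add: x_def of_real_def scaleR_right_diff_distrib)
  then have "norm x = norm (of_real t - h) / t" using t by simp
  then have "norm x \<le> 1" using n t by (simp add: divide_le_eq_1)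
  moreover have "cstar x = x" by (simp add: x_def cstar_diff cstar_scaleR sa)
  ultimately obtain s where s: "cstar s = s" "s * s = 1 - x" "norm (1 - s) \<le> 1"
      and com: "\<And>z. z * x = x * z \<Longrightarrow> z * s = s * z"
    using square_root_one_minus by metis
  show thesis
  proof (rule that[of "sqrt t *\<^sub>R s"])
    show "cstar (sqrt t *\<^sub>R s) = sqrt t *\<^sub>R s" by (simp add: cstar_scaleR s)
    show "(sqrt t *\<^sub>R s) * (sqrt t *\<^sub>R s) = h" using t by (simp add: s x_def)
    have "of_real (sqrt t) - sqrt t *\<^sub>R s = sqrt t *\<^sub>R (1 - s)"
      by (simp add: of_real_def scaleR_right_diff_distrib)
    then show "norm (of_real (sqrt t) - sqrt t *\<^sub>R s) \<le> sqrt t"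
      using s(3) t by simp
    show "z * (sqrt t *\<^sub>R s) = (sqrt t *\<^sub>R s) * z" if "z * h = h * z" for z
      using com[of z] that by (simp add: x_def algebra_simps)
  qed
qed

lemma positiveI: "cstar h = h \<Longrightarrow> norm (of_real t - h) \<le> t \<Longrightarrow> positive h"
  by (metis positive_root positive_square)

lemma positive_zero [simp]: "positive 0"
  using positive_square[of 0] by simp

text \<open>A sum of squares is not visibly a square, but the bounds
  \<open>norm (of_real t - h) \<le> t\<close> add up by the triangle inequality.\<close>

lemma positive_add:
  assumes "positive a" "positive b"
  shows "positive (a + b)"
proof (rule positiveI)
  show "cstar (a + b) = a + b" using assms by (simp add: cstar_add positive_selfadjoint)
  have e: "of_real (norm a + norm b) - (a + b) = (of_real (norm a) - a) + (of_real (norm b) - b)"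
    by simp
  show "norm (of_real (norm a + norm b) - (a + b)) \<le> norm a + norm b"
    unfolding e
    by (intro order_trans[OF norm_triangle_ineq] add_mono norm_scalar_minus_positive assms order_refl)
qed

lemma positive_scaleR:
  assumes "positive a" "0 \<le> r"
  shows "positive (r *\<^sub>R a)"
proof -
  obtain k where "cstar k = k" "k * k = a" using assms(1) by (auto simp: positive_def)
  then have "r *\<^sub>R a = (sqrt r *\<^sub>R k) * (sqrt r *\<^sub>R k)" "cstar (sqrt r *\<^sub>R k) = sqrt r *\<^sub>R k"
    using assms(2) by (simp_all add: cstar_scaleR)
  then show ?thesis by (metis positive_square)
qed

lemma positive_sum: "(\<And>i. i \<in> A \<Longrightarrow> positive (f i)) \<Longrightarrow> positive (sum f A)"
  by (induction A rule: infinite_finite_induct) (simp_all add: positive_add)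

text \<open>The constant 2 is not optimal, but any constant will do for comparing norms on columns.\<close>

lemma norm_le_twice_norm_add_positive:
  fixes a b :: "'a::unital_cstar_algebra"
  assumes a: "positive a" and b: "positive b"
  shows "norm a \<le> 2 * norm (a + b)"
proof -
  define s T where "s = norm a" and "T = norm (a + b)"
  have sa: "cstar a = a" "cstar (a + b) = a + b"
    using a b positive_selfadjoint positive_add by blast+
  \<comment> \<open>The distance of this element from \<open>T\<close> is
    \<open>norm (a + b) = T\<close>. Adding \<open>b\<close> then gives that \<open>T - a\<close> is
    positive.\<close>
  have "positive (of_real T - (a + b))"
    by (rule positiveI[of _ T]) (simp_all only: cstar_diff sa T_def cstar_of_real diff_diff_eq2 add_diff_cancel_left' order_refl)
  then have "positive ((of_real T - (a + b)) + b)" using b by (rule positive_add)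
  moreover have "norm (of_real T - a) \<le> T + s"
    using norm_triangle_ineq4[of "of_real T" a] by (simp add: T_def s_def)
  ultimately have "norm (of_real (T + s) - (of_real T - a)) \<le> T + s"
    using norm_scalar_minus_positive[of "of_real T - a" "T + s"] by simp
  then have plus: "norm (of_real s + a) \<le> T + s" by simp
  have minus: "norm (of_real s - a) \<le> s"
    using norm_scalar_minus_positive[OF a] by (simp add: s_def)
  \<comment> \<open>Polarization turns the two bounds into a quadratic inequality,
    \<open>2 s s \<le> 2 T s + T T\<close>. It yields \<open>s \<le> T (1 + sqrt 3) / 2\<close>,
    which is below \<open>2 T\<close>.\<close>
  have "(4 * s) *\<^sub>R a = (of_real s + a) * (of_real s + a) - (of_real s - a) * (of_real s - a)"
    unfolding of_real_def by (simp add: algebra_simps flip: scaleR_add_left)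
  then have "4 * s * s \<le> norm ((of_real s + a) * (of_real s + a)) + norm ((of_real s - a) * (of_real s - a))"
    using norm_triangle_ineq4 norm_scaleR[of "4 * s" a] unfolding s_def by (metis abs_norm_cancel abs_mult abs_numeral)
  also have "\<dots> \<le> (T + s) * (T + s) + s * s"
    by (intro add_mono order_trans[OF norm_mult_ineq] mult_mono plus minus) 
       (simp_all add: s_def T_def)
  finally have le: "4 * s * s \<le> (T + s) * (T + s) + s * s" .
  have "s \<le> 2 * T"
  proof (rule ccontr)
    assume "\<not> s \<le> 2 * T"
    moreover have "0 \<le> T" by (simp add: T_def)
    ultimately have l: "2 * T < s" "0 \<le> T" "0 < s" by linarith+
    have "2 * T * s \<le> s * s" "T * T \<le> T * s" "T * s < s * s" 
      using l by (auto intro!: mult_right_mono mult_left_mono mult_strict_right_mono)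
    moreover have "T * T * 2 \<le> T * s" using mult_left_mono[of "2 * T" s T] l by (simp add: algebra_simps)
    ultimately show False using le by (simp add: algebra_simps)
  qed
  then show ?thesis by (simp add: s_def T_def)
qed

text \<open>Multiplying out one factor \<open>T + q\<close> gives \<open>T\<close> times the
  expression for \<open>n\<close> plus the same expression with \<open>Suc j\<close>, so
  \<open>j\<close> must vary in the induction. The base case is \<open>q ^ j = k ^ j * k ^ j\<close>
  for a root \<open>k\<close> of \<open>q\<close>.\<close>

lemma positive_power_mult_scalar_add:
  fixes q :: "'a::unital_cstar_algebra"
  assumes "positive q" "0 \<le> T" "1 \<le> j"
  shows "positive (q ^ j * (of_real T + q) ^ n)"
  using assms(3)
proof (induction n arbitrary: j)
  case 0
  obtain k where k: "cstar k = k" "k * k = q" using assms(1) by (auto simp: positive_def)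
  have "q ^ j = (k ^ 2) ^ j" by (simp only: k(2) power2_eq_square)
  also have "\<dots> = k ^ (j + j)" by (simp only: power_mult[symmetric] mult_2)
  also have "\<dots> = k ^ j * k ^ j" by (rule power_add)
  finally have "q ^ j = k ^ j * k ^ j" .
  then show ?case using positive_square[of "k ^ j"] k by (simp add: cstar_power)
next
  case (Suc n)
  define w where "w = (of_real T + q) ^ n"
  have "q ^ j * (of_real T + q) ^ Suc n = q ^ j * (of_real T * w + q * w)"
    by (simp only: w_def power_Suc distrib_right)
  also have "\<dots> = T *\<^sub>R (q ^ j * w) + q ^ Suc j * w"
    by (simp only: of_real_def power_Suc2 distrib_left mult.assoc mult_scaleR_left mult_scaleR_right
        mult_1_left)
  finally have eq: "q ^ j * (of_real T + q) ^ Suc n =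
      T *\<^sub>R (q ^ j * (of_real T + q) ^ n) + q ^ Suc j * (of_real T + q) ^ n"
    by (simp only: w_def)
  show ?case
    unfolding eq by (intro positive_add positive_scaleR Suc.IH) (use Suc.prems assms in auto)
qed

text \<open>With \<open>c c\<^sup>* \<ge> 0\<close> and \<open>T = \<parallel>c c\<^sup>*\<parallel>\<close>, the
  element \<open>q (T + q)\<^sup>n = - c\<^sup>* (T - c c\<^sup>*)\<^sup>n c\<close> has norm at most
  \<open>\<parallel>c\<parallel>\<^sup>2 T\<^sup>n\<close>, but it dominates \<open>n T\<^sup>n\<^sup>-\<^sup>1 q\<^sup>2\<close>.\<close>

lemma cstar_mult_negative_eq_zero:
  fixes c :: "'a::unital_cstar_algebra"
  assumes q: "positive q" and cq: "cstar c * c = - q"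
  shows "c = 0"
proof -
  define p T where "p = c * cstar c" and "T = norm p"
  have T0: "0 \<le> T" by (simp add: T_def)
  \<comment> \<open>These are twice the real part and minus twice the imaginary part of
    \<open>c\<close>. Their squares add up to \<open>2 (p - q)\<close>, so \<open>p\<close> is
    \<open>q\<close> plus a positive element.\<close>
  define d e where "d = c + cstar c" and "e = scaleC \<i> (c - cstar c)"
  have sa: "cstar d = d" "cstar e = e"
    by (simp_all add: d_def e_def cstar_add cstar_cstar cstar_scaleC cstar_diff scaleC_minus_left
        scaleC_diff_right)
  have ee: "e * e = (c - cstar c) * (cstar c - c)"
    unfolding e_def mult_scaleC_left mult_scaleC_right scaleC_scaleC
    by (simp add: scaleC_minus_left scaleC_one algebra_simps)
  have q_eq: "q = - (cstar c * c)" by (simp add: cq)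
  have "d * d + e * e = (p - q) + (p - q)"
    unfolding ee d_def p_def q_eq by (simp add: algebra_simps)
  then have "p = q + (1/2) *\<^sub>R (d * d + e * e)"
    by (simp flip: scaleR_2)
  then have "positive p"
    using q sa by (simp add: positive_add positive_scaleR positive_square)
  then have Tp: "norm (of_real T - p) \<le> T"
    by (simp add: norm_scalar_minus_positive T_def)
  \<comment> \<open>\<open>T + q\<close> is \<open>T - cstar c * c\<close>, and \<open>c\<close>
    moves past it: \<open>c * (T - cstar c * c) = (T - c * cstar c) * c\<close>. The powers of
    \<open>T + q\<close> thus become powers of \<open>T - p\<close>, whose norm is at most
    \<open>T\<close>.\<close>
  have conj: "q * (of_real T + q) ^ n = - (cstar c * (of_real T - p) ^ n * c)" for n
  proof (induction n)
    case (Suc n)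
    have "q * (of_real T + q) ^ Suc n = (q * (of_real T + q) ^ n) * (of_real T + q)"
      by (simp only: power_Suc2 mult.assoc)
    also have "\<dots> = - (cstar c * (of_real T - p) ^ n * (c * (of_real T - cstar c * c)))"
      using cq by (simp add: Suc mult.assoc)
    also have "c * (of_real T - cstar c * c) = (of_real T - p) * c"
      by (simp add: p_def left_diff_distrib right_diff_distrib mult.assoc of_real_def)
    finally show ?case by (simp only: power_Suc2 mult.assoc)
  qed (simp add: cq)
  have upper: "norm (q * (of_real T + q) ^ n) \<le> norm c ^ 2 * T ^ n" for n
  proof -
    have "norm (cstar c * (of_real T - p) ^ n * c) \<le> norm (cstar c) * norm ((of_real T - p) ^ n) * norm c"
      by (meson norm_ge_zero mult_right_mono norm_mult_ineq order_trans)
    also have "\<dots> \<le> norm c * T ^ n * norm c"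
      using order_trans[OF norm_power_ineq power_mono[OF Tp norm_ge_zero]]
      by (intro mult_right_mono mult_mono) auto
    finally show ?thesis by (simp add: conj power2_eq_square mult_ac)
  qed
  have E: "positive (q ^ 2 * ((of_real T + q) ^ n - of_real (T ^ n)))" for n
  proof (induction n)
    case (Suc n)
    have "q ^ 2 * ((of_real T + q) ^ Suc n - of_real (T ^ Suc n)) =
        T *\<^sub>R (q ^ 2 * ((of_real T + q) ^ n - of_real (T ^ n))) + q ^ 3 * (of_real T + q) ^ n"
      by (simp add: of_real_def distrib_left distrib_right left_diff_distrib right_diff_distrib
          mult.assoc power2_eq_square power3_eq_cube scaleR_diff_right)
    then show ?case
      using Suc positive_power_mult_scalar_add[OF q T0, of 3] T0
      by (auto intro!: positive_add positive_scaleR)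
  qed simp
  \<comment> \<open>The extra factor \<open>T\<close> avoids the exponent \<open>n - 1\<close>. The
    increment from \<open>n\<close> to \<open>Suc n\<close> is the positive element of
    \<open>E\<close>, multiplied by \<open>T\<close>.\<close>
  have D: "positive (T *\<^sub>R (q * (of_real T + q) ^ n) - (real n * T ^ n) *\<^sub>R q ^ 2)" for n
  proof (induction n)
    case 0 then show ?case using q T0 by (simp add: positive_scaleR)
  next
    case (Suc n)
    have "T *\<^sub>R (q * (of_real T + q) ^ Suc n) - (real (Suc n) * T ^ Suc n) *\<^sub>R q ^ 2 =
        T *\<^sub>R (T *\<^sub>R (q * (of_real T + q) ^ n) - (real n * T ^ n) *\<^sub>R q ^ 2) +
        T *\<^sub>R (q ^ 2 * ((of_real T + q) ^ n - of_real (T ^ n)))"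
      by (simp add: of_real_def distrib_left distrib_right left_diff_distrib right_diff_distrib
          scaleR_diff_right scaleR_add_left scaleR_add_right mult.assoc power2_eq_square)
    then show ?case
      using Suc E T0 by (auto intro!: positive_add positive_scaleR)
  qed
  have bound: "T ^ n * (real n * norm (q ^ 2)) \<le> T ^ n * (2 * T * norm c ^ 2)" for n
  proof -
    have "positive ((real n * T ^ n) *\<^sub>R q ^ 2)"
      using q T0 positive_selfadjoint by (auto simp: power2_eq_square intro!: positive_scaleR positive_square)
    from norm_le_twice_norm_add_positive[OF this D[of n]]
    have "real n * T ^ n * norm (q ^ 2) \<le> 2 * (T * norm (q * (of_real T + q) ^ n))"
      using T0 by simp
    also have "\<dots> \<le> 2 * (T * (norm c ^ 2 * T ^ n))"
      by (intro mult_left_mono upper T0) simp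
    finally show ?thesis by (simp add: mult_ac)
  qed
  show ?thesis
  proof (cases "T = 0")
    case True
    then show ?thesis using cstar_identity[of "cstar c"] by (simp add: T_def p_def cstar_cstar)
  next
    case False
    then have *: "real n * norm (q ^ 2) \<le> 2 * T * norm c ^ 2" for n
      using bound[of n] T0 by (simp add: mult_le_cancel_left)
    have "norm (q ^ 2) \<le> 0"
    proof (rule ccontr)
      assume "\<not> norm (q ^ 2) \<le> 0"
      then obtain n where "2 * T * norm c ^ 2 < real n * norm (q ^ 2)"
        using reals_Archimedean3 by (metis not_le)
      then show False using *[of n] by simp
    qed
    then have "norm q ^ 2 \<le> 0"
      using norm_square_selfadjoint[OF positive_selfadjoint[OF q]] by (simp add: power2_eq_square)
    then have "q = 0" by simp
    then show ?thesis using cstar_identity[of c] cq by simp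
  qed
qed

text \<open>Here \<open>m\<close> is the absolute value of \<open>h\<close>, and it suffices to show
  \<open>g = m - h = 0\<close>. Since \<open>m * g = - (h * g)\<close>, conjugating \<open>h\<close>
  by \<open>g\<close> gives minus a square, while it also equals
  \<open>cstar (a * g) * (a * g)\<close>. By the preceding lemma \<open>a * g = 0\<close>, hence
  \<open>h * g = 0\<close> and \<open>g * g = 0\<close>.\<close>

theorem positive_cstar_mult: "positive (cstar a * a)" for a :: "'a::unital_cstar_algebra"
proof -
  define h where "h = cstar a * a"
  have sa: "cstar h = h" by (simp add: h_def cstar_mult cstar_cstar)
  have hh: "positive (h * h)" by (rule positive_square[OF sa])
  obtain m where m: "cstar m = m" "m * m = h * h"
      "norm (of_real (sqrt (norm (h * h))) - m) \<le> sqrt (norm (h * h))"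
      and com_m: "\<And>z. z * (h * h) = (h * h) * z \<Longrightarrow> z * m = m * z"
    by (rule positive_root[OF positive_selfadjoint[OF hh] norm_scalar_minus_positive[OF hh order_refl]]) blast
  have hm: "h * m = m * h" using com_m[of h] by (simp add: mult.assoc)
  have m_pos: "positive m" using m(1,3) positiveI by blast
  obtain l where l: "cstar l = l" "l * l = m" and com_l: "\<And>z. z * m = m * z \<Longrightarrow> z * l = l * z"
    by (rule positive_root[OF m(1,3)]) blast
  \<comment> \<open>\<open>g\<close> is twice the negative part of \<open>h\<close>\<close>
  define g where "g = m - h"
  have g: "cstar g = g" by (simp add: g_def cstar_diff m sa)
  have gm: "g * m = m * g" using hm by (simp add: g_def algebra_simps)
  have gl: "g * l = l * g" using com_l gm by simp
  have mg: "m * g = - (h * g)" using hm by (simp add: g_def algebra_simps m(2))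
  have "cstar (a * g) * (a * g) = g * (h * g)"
    by (simp add: cstar_mult g h_def mult.assoc)
  also have "\<dots> = - (g * (m * g))" by (simp add: mg)
  also have "g * (m * g) = (l * g) * (l * g)"
    by (metis gl l(2) mult.assoc)
  finally have "a * g = 0"
    by (rule cstar_mult_negative_eq_zero[rotated])
       (simp add: positive_square cstar_mult g l(1) gl)
  then have "h * g = 0" by (simp add: h_def mult.assoc)
  moreover have "g * g = m * g - h * g" by (simp add: g_def algebra_simps)
  ultimately have "g * g = 0" by (simp add: mg)
  then have "g = 0" using norm_square_selfadjoint[OF g] by simp
  then show ?thesis using m_pos by (simp add: g_def h_def)
qed

section \<open>Norms of matrices\<close>

text \<open>One positive summand is bounded by twice the whole sum, and \<open>sqrt 2\<close> is the
  root of that constant.\<close>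

lemma norm_entry_le_column_norm:
  assumes "i < dim_vec v"
  shows "norm (v $ i) \<le> sqrt 2 * column_norm v"
proof -
  have "(\<Sum>k<dim_vec v. cstar (v $ k) * v $ k) =
      cstar (v $ i) * v $ i + (\<Sum>k\<in>{..<dim_vec v} - {i}. cstar (v $ k) * v $ k)"
    using assms by (intro sum.remove) auto
  then have "norm (cstar (v $ i) * v $ i) \<le> 2 * norm (\<Sum>k<dim_vec v. cstar (v $ k) * v $ k)"
    by (simp add: norm_le_twice_norm_add_positive positive_cstar_mult positive_sum)
  then have "norm (v $ i) \<le> sqrt (2 * norm (\<Sum>k<dim_vec v. cstar (v $ k) * v $ k))"
    by (intro real_le_rsqrt) (simp add: cstar_identity)
  then show ?thesis by (simp add: column_norm_def real_sqrt_mult)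
qed

lemma column_norm_nonneg: "0 \<le> column_norm v"
  by (simp add: column_norm_def)

lemma column_norm_le_sum: "column_norm v \<le> (\<Sum>i<dim_vec v. norm (v $ i))"
proof -
  let ?f = "\<lambda>i. norm (v $ i)"
  have "norm (\<Sum>i<dim_vec v. cstar (v $ i) * v $ i) \<le> (\<Sum>i<dim_vec v. ?f i * ?f i)"
    by (rule order_trans[OF norm_sum]) (simp add: cstar_identity power2_eq_square)
  also have "\<dots> \<le> (\<Sum>i<dim_vec v. ?f i * (\<Sum>i<dim_vec v. ?f i))"
    by (intro sum_mono mult_left_mono member_le_sum) auto
  finally have "norm (\<Sum>i<dim_vec v. cstar (v $ i) * v $ i) \<le> (\<Sum>i<dim_vec v. ?f i) ^ 2"
    by (simp add: power2_eq_square sum_distrib_right)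
  then show ?thesis
    unfolding column_norm_def by (intro real_le_lsqrt) (auto intro: sum_nonneg)
qed

text \<open>Submultiplicative, and additive on block sums, which makes it more convenient than
  \<open>mat_norm\<close> in estimates.\<close>

definition entry_norm :: "'a::real_normed_vector mat \<Rightarrow> real" where
  "entry_norm A = (\<Sum>i<dim_row A. \<Sum>j<dim_col A. norm (A $$ (i, j)))"

lemma entry_norm_nonneg: "0 \<le> entry_norm A"
  by (simp add: entry_norm_def sum_nonneg)

lemma entry_norm_zero [simp]: "entry_norm (0\<^sub>m m n) = 0"
  by (simp add: entry_norm_def)

lemma norm_entry_le_entry_norm:
  assumes "i < dim_row A" "j < dim_col A"
  shows "norm (A $$ (i, j)) \<le> entry_norm A"
proof -
  have "norm (A $$ (i, j)) \<le> (\<Sum>j<dim_col A. norm (A $$ (i, j)))"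
    using assms by (intro member_le_sum) auto
  also have "\<dots> \<le> entry_norm A"
    unfolding entry_norm_def using assms by (intro member_le_sum) (auto intro: sum_nonneg)
  finally show ?thesis .
qed

lemma entry_norm_add:
  assumes "A \<in> carrier_mat m n" "B \<in> carrier_mat m n"
  shows "entry_norm (A + B) \<le> entry_norm A + entry_norm B"
  using assms by (auto simp: entry_norm_def simp flip: sum.distrib intro!: sum_mono norm_triangle_ineq)

lemma entry_norm_mult:
  fixes A B :: "'a::real_normed_algebra_1 mat"
  assumes "A \<in> carrier_mat l m" "B \<in> carrier_mat m n"
  shows "entry_norm (A * B) \<le> entry_norm A * entry_norm B"
proof -
  have "entry_norm (A * B) \<le>
      (\<Sum>i<l. \<Sum>j<n. \<Sum>k<m. norm (A $$ (i, k)) * norm (B $$ (k, j)))"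
    using assms
    by (auto simp: entry_norm_def scalar_prod_def lessThan_atLeast0
        intro!: sum_mono order_trans[OF norm_sum] norm_mult_ineq)
  also have "\<dots> = (\<Sum>i<l. \<Sum>k<m. norm (A $$ (i, k)) * (\<Sum>j<n. norm (B $$ (k, j))))"
    unfolding sum_distrib_left by (rule sum.cong[OF refl]) (rule sum.swap)
  also have "\<dots> \<le> (\<Sum>i<l. \<Sum>k<m. norm (A $$ (i, k)) * entry_norm B)"
    using assms
    by (auto simp: entry_norm_def intro!: sum_mono mult_left_mono sum_nonneg
        member_le_sum[where f = "\<lambda>k. \<Sum>j<n. norm (B $$ (k, j))"])
  also have "\<dots> = entry_norm A * entry_norm B"
    using assms by (simp add: entry_norm_def[of A] sum_distrib_right)
  finally show ?thesis .
qed

text \<open>This bounds the set whose supremum is \<open>mat_norm A\<close>; a real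
  \<open>Sup\<close> says nothing about an unbounded set.\<close>

lemma column_norm_mult_le:
  fixes A :: "'a::unital_cstar_algebra mat"
  assumes "v \<in> carrier_vec (dim_col A)" "column_norm v \<le> 1"
  shows "column_norm (A *\<^sub>v v) \<le> sqrt 2 * entry_norm A"
proof -
  have v: "norm (v $ j) \<le> sqrt 2" if "j < dim_col A" for j
  proof -
    have "norm (v $ j) \<le> sqrt 2 * column_norm v"
      using norm_entry_le_column_norm[of j v] that assms by simp
    also have "\<dots> \<le> sqrt 2 * 1"
      using assms by (intro mult_left_mono) auto
    finally show ?thesis by simp
  qed
  have "column_norm (A *\<^sub>v v) \<le> (\<Sum>i<dim_row A. norm ((A *\<^sub>v v) $ i))"
    using column_norm_le_sum[of "A *\<^sub>v v"] by simp
  also have "\<dots> \<le> (\<Sum>i<dim_row A. \<Sum>j<dim_col A. norm (A $$ (i, j)) * sqrt 2)"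
    using assms v
    by (auto simp: scalar_prod_def lessThan_atLeast0
        intro!: sum_mono order_trans[OF norm_sum] order_trans[OF norm_mult_ineq] mult_left_mono)
  also have "\<dots> = sqrt 2 * entry_norm A"
    by (simp add: entry_norm_def sum_distrib_left mult.commute)
  finally show ?thesis .
qed

lemma column_norm_le_mat_norm:
  fixes A :: "'a::unital_cstar_algebra mat"
  assumes "v \<in> carrier_vec (dim_col A)" "column_norm v \<le> 1"
  shows "column_norm (A *\<^sub>v v) \<le> mat_norm A"
  unfolding mat_norm_def
proof (rule cSup_upper)
  show "bdd_above {column_norm (A *\<^sub>v v) |v. v \<in> carrier_vec (dim_col A) \<and> column_norm v \<le> 1}"
    by (rule bdd_aboveI[where M = "sqrt 2 * entry_norm A"]) (auto intro: column_norm_mult_le)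
qed (use assms in auto)

lemma column_norm_zero: "column_norm (0\<^sub>v n :: 'a::unital_cstar_algebra vec) = 0"
  by (simp add: column_norm_def)

lemma mat_norm_le: "mat_norm A \<le> sqrt 2 * entry_norm (A :: 'a::unital_cstar_algebra mat)"
  unfolding mat_norm_def
proof (rule cSup_least)
  show "{column_norm (A *\<^sub>v v) |v. v \<in> carrier_vec (dim_col A) \<and> column_norm v \<le> 1} \<noteq> {}"
    using column_norm_zero[of "dim_col A", where 'a = 'a] by (auto intro!: exI[of _ "0\<^sub>v (dim_col A)"])
qed (auto intro: column_norm_mult_le)

lemma mat_norm_nonneg: "0 \<le> mat_norm (A :: 'a::unital_cstar_algebra mat)"
  using column_norm_le_mat_norm[of "0\<^sub>v (dim_col A)" A] column_norm_nonneg[of "A *\<^sub>v 0\<^sub>v (dim_col A)"]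
  by (simp add: column_norm_zero)

lemma norm_entry_le_mat_norm:
  fixes A :: "'a::unital_cstar_algebra mat"
  assumes "i < dim_row A" "j < dim_col A"
  shows "norm (A $$ (i, j)) \<le> sqrt 2 * mat_norm A"
proof -
  let ?u = "unit_vec (dim_col A) j :: 'a vec"
  have "(\<Sum>k<dim_col A. cstar (?u $ k) * ?u $ k) = (\<Sum>k<dim_col A. if k = j then 1 else 0)"
    using assms by (intro sum.cong) auto
  then have u: "column_norm ?u \<le> 1"
    using assms by (simp add: column_norm_def)
  have "(A *\<^sub>v ?u) $ i = (\<Sum>k<dim_col A. A $$ (i, k) * ?u $ k)"
    using assms by (simp add: scalar_prod_def lessThan_atLeast0)
  also have "\<dots> = (\<Sum>k<dim_col A. if k = j then A $$ (i, j) else 0)"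
    using assms by (intro sum.cong) auto
  finally have "(A *\<^sub>v ?u) $ i = A $$ (i, j)" using assms by simp
  then have "norm (A $$ (i, j)) \<le> sqrt 2 * column_norm (A *\<^sub>v ?u)"
    using norm_entry_le_column_norm[of i "A *\<^sub>v ?u"] assms by simp
  also have "\<dots> \<le> sqrt 2 * mat_norm A"
    using column_norm_le_mat_norm[OF _ u] by simp
  finally show ?thesis .
qed

lemma entry_norm_le_mat_norm:
  fixes A :: "'a::unital_cstar_algebra mat"
  shows "entry_norm A \<le> real (dim_row A * dim_col A) * sqrt 2 * mat_norm A"
proof -
  have "entry_norm A \<le> (\<Sum>i<dim_row A. \<Sum>j<dim_col A. sqrt 2 * mat_norm A)"
    unfolding entry_norm_def by (intro sum_mono norm_entry_le_mat_norm) auto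
  then show ?thesis by (simp add: mult.assoc)
qed

section \<open>The Cuntz relation in terms of entries\<close>

text \<open>The two norms agree up to factors that depend only on the dimensions of
  \<open>A\<close>, which stay fixed along the sequence. Conversely, errors below
  \<open>1 / (k + 1)\<close> are chosen for each \<open>k\<close>.\<close>

lemma cuntz_le_iff:
  fixes A B :: "'a::unital_cstar_algebra mat"
  shows "cuntz_le A B \<longleftrightarrow>
    (\<forall>e>0. \<exists>C\<in>carrier_mat (dim_row A) (dim_row B). \<exists>D\<in>carrier_mat (dim_col B) (dim_col A).
       entry_norm (C * B * D - A) < e)" (is "_ \<longleftrightarrow> ?R")
proof
  assume "cuntz_le A B"
  then obtain C D where CD: "C k \<in> carrier_mat (dim_row A) (dim_row B)"
      "D k \<in> carrier_mat (dim_col B) (dim_col A)" 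
    and lim: "(\<lambda>k. mat_norm (C k * B * D k - A)) \<longlonglongrightarrow> 0" for k :: nat
    unfolding cuntz_le_def by blast
  let ?K = "real (dim_row A * dim_col A) * sqrt 2"
  have le: "entry_norm (C k * B * D k - A) \<le> ?K * mat_norm (C k * B * D k - A)" for k
    using entry_norm_le_mat_norm[of "C k * B * D k - A"] by simp
  have "(\<lambda>k. ?K * mat_norm (C k * B * D k - A)) \<longlonglongrightarrow> ?K * 0"
    by (intro tendsto_intros lim)
  then have up: "(\<lambda>k. ?K * mat_norm (C k * B * D k - A)) \<longlonglongrightarrow> 0" by simp
  have "(\<lambda>k. entry_norm (C k * B * D k - A)) \<longlonglongrightarrow> 0"
    by (rule tendsto_sandwich[OF _ _ tendsto_const up]) (use le in \<open>auto simp: entry_norm_nonneg\<close>)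
  then have "eventually (\<lambda>k. entry_norm (C k * B * D k - A) < e) sequentially" if "e > 0" for e
    using that by (simp add: order_tendstoD)
  then show ?R using CD by (meson eventually_happens' sequentially_bot)
next
  assume ?R
  then have "\<forall>k::nat. \<exists>C D. C \<in> carrier_mat (dim_row A) (dim_row B) \<and>
      D \<in> carrier_mat (dim_col B) (dim_col A) \<and> entry_norm (C * B * D - A) < inverse (real (Suc k))"
    by (simp add: Bex_def del: of_nat_Suc)
  then obtain C D where CD: "\<And>k. C k \<in> carrier_mat (dim_row A) (dim_row B)"
      "\<And>k. D k \<in> carrier_mat (dim_col B) (dim_col A)"
      "\<And>k. entry_norm (C k * B * D k - A) < inverse (real (Suc k))"
    by metis
  have le: "mat_norm (C k * B * D k - A) \<le> sqrt 2 * inverse (real (Suc k))" for k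
    using CD(3)[of k] by (intro order_trans[OF mat_norm_le]) simp
  have "(\<lambda>k. sqrt 2 * inverse (real (Suc k))) \<longlonglongrightarrow> sqrt 2 * 0"
    by (intro tendsto_intros LIMSEQ_inverse_real_of_nat)
  then have up: "(\<lambda>k. sqrt 2 * inverse (real (Suc k))) \<longlonglongrightarrow> 0" by simp
  have "(\<lambda>k. mat_norm (C k * B * D k - A)) \<longlonglongrightarrow> 0"
    by (rule tendsto_sandwich[OF _ _ tendsto_const up])
       (intro always_eventually allI le mat_norm_nonneg)+
  then show "cuntz_le A B" unfolding cuntz_le_def using CD by blast
qed

lemma cuntz_le_factor:
  fixes B C D :: "'a::unital_cstar_algebra mat"
  assumes "C \<in> carrier_mat m (dim_row B)" "D \<in> carrier_mat (dim_col B) n"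
  shows "cuntz_le (C * B * D) B"
  unfolding cuntz_le_iff
proof (intro allI impI bexI)
  show "entry_norm (C * B * D - C * B * D) < e" if "0 < e" for e
    using that assms by (subst minus_r_inv_mat[of _ m n]) auto
qed (use assms in auto)

lemma cuntz_le_refl: "cuntz_le A (A :: 'a::unital_cstar_algebra mat)"
proof -
  have "1\<^sub>m (dim_row A) * A * 1\<^sub>m (dim_col A) = A" by simp
  then show ?thesis using cuntz_le_factor[of "1\<^sub>m (dim_row A)" "dim_row A" A "1\<^sub>m (dim_col A)" "dim_col A"] by simp
qed

lemma cuntz_le_trans:
  fixes A B E :: "'a::unital_cstar_algebra mat"
  assumes AB: "cuntz_le A B" and BE: "cuntz_le B E"
  shows "cuntz_le A E"
  unfolding cuntz_le_iff
proof (intro allI impI)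
  fix e :: real assume e: "0 < e"
  define ar ac br bc er ec where dims: "ar = dim_row A" "ac = dim_col A" "br = dim_row B"
    "bc = dim_col B" "er = dim_row E" "ec = dim_col E"
  obtain C D where C: "C \<in> carrier_mat ar br" and D: "D \<in> carrier_mat bc ac"
      and CD: "entry_norm (C * B * D - A) < e / 2"
    using AB e unfolding cuntz_le_iff dims by (meson half_gt_zero)
  let ?K = "entry_norm C * entry_norm D"
  have K: "0 \<le> ?K" by (simp add: entry_norm_nonneg)
  \<comment> \<open>The error in approximating \<open>B\<close> is multiplied by at most
    \<open>?K\<close>; the summand 1 keeps the quotient defined for \<open>?K = 0\<close>.\<close>
  have pos: "0 < e / (2 * (?K + 1))" using e K by simp
  obtain F G where F: "F \<in> carrier_mat br er" and G: "G \<in> carrier_mat ec bc"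
      and FG: "entry_norm (F * E * G - B) < e / (2 * (?K + 1))"
    using BE pos unfolding cuntz_le_iff dims by meson
  have A: "A \<in> carrier_mat ar ac" and B: "B \<in> carrier_mat br bc" and E: "E \<in> carrier_mat er ec"
    by (auto simp: dims)
  have M: "F * E * G \<in> carrier_mat br bc" using F E G by auto
  have CB: "C * B \<in> carrier_mat ar bc" using C B by auto
  have "C * (F * E * G - B) * D = C * (F * E * G) * D - C * B * D"
    unfolding mult_minus_distrib_mat[OF C M B]
    by (rule minus_mult_distrib_mat[OF mult_carrier_mat[OF C M] CB D])
  moreover have "C * (F * E * G) * D = C * F * E * (G * D)"
    unfolding assoc_mult_mat[OF C F E] assoc_mult_mat[OF C mult_carrier_mat[OF F E] G, symmetric]
    by (rule assoc_mult_mat[OF mult_carrier_mat[OF C mult_carrier_mat[OF F E]] G D])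
  moreover have "C * F * E * (G * D) - A = (C * F * E * (G * D) - C * B * D) + (C * B * D - A)"
    using C D B A E F G by (intro eq_matI) auto
  ultimately have eq: "C * F * E * (G * D) - A = C * (F * E * G - B) * D + (C * B * D - A)"
    by simp
  have "entry_norm (C * F * E * (G * D) - A) \<le>
      entry_norm (C * (F * E * G - B) * D) + entry_norm (C * B * D - A)"
    unfolding eq using C D A B M by (intro entry_norm_add[of _ ar ac]) auto
  also have "entry_norm (C * (F * E * G - B) * D) \<le>
      entry_norm C * entry_norm (F * E * G - B) * entry_norm D"
    using C D B M
    by (intro order_trans[OF entry_norm_mult[of _ ar bc _ ac]] mult_right_mono
        entry_norm_mult[of _ ar br _ bc] entry_norm_nonneg) auto
  also have "\<dots> = ?K * entry_norm (F * E * G - B)" by (simp only: mult_ac)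
  also have "\<dots> \<le> ?K * (e / (2 * (?K + 1)))"
    using FG K by (intro mult_left_mono) auto
  also have "\<dots> \<le> e / 2" using K e by (simp add: field_simps)
  finally have "entry_norm (C * F * E * (G * D) - A) < e" using CD by linarith
  then show "\<exists>C\<in>carrier_mat (dim_row A) (dim_row E). \<exists>D\<in>carrier_mat (dim_col E) (dim_col A).
      entry_norm (C * E * D - A) < e"
    using C D F G unfolding dims by (meson mult_carrier_mat)
qed

section \<open>The Cuntz semigroup as an ordered monoid\<close>

lemma dim_block_diag [simp]:
  "dim_row (block_diag A B) = dim_row A + dim_row B"
  "dim_col (block_diag A B) = dim_col A + dim_col B"
  by (simp_all add: block_diag_def)

lemma block_diag_carrier:
  "A \<in> carrier_mat m n \<Longrightarrow> B \<in> carrier_mat m' n' \<Longrightarrow> block_diag A B \<in> carrier_mat (m + m') (n + n')"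
  by (auto simp: block_diag_def)

lemma block_diag_mult:
  fixes A B C D :: "'a::semiring_0 mat"
  assumes "A \<in> carrier_mat l m" "C \<in> carrier_mat m n"
    "B \<in> carrier_mat l' m'" "D \<in> carrier_mat m' n'"
  shows "block_diag A B * block_diag C D = block_diag (A * C) (B * D)"
proof -
  have "block_diag A B * block_diag C D =
     four_block_mat (A * C + 0\<^sub>m l m' * 0\<^sub>m m' n) (A * 0\<^sub>m m n' + 0\<^sub>m l m' * D)
       (0\<^sub>m l' m * C + B * 0\<^sub>m m' n) (0\<^sub>m l' m * 0\<^sub>m m n' + B * D)"
    using assms unfolding block_diag_def
    by (subst mult_four_block_mat[of _ l m _ m' _ l' _ _ n _ n']) auto
  then show ?thesis using assms by (simp add: block_diag_def)
qed

lemma block_diag_assoc: "block_diag (block_diag A B) C = block_diag A (block_diag B C)"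
  unfolding block_diag_def by (rule assoc_four_block_mat[symmetric])

lemma block_diag_empty [simp]: "block_diag (0\<^sub>m 0 0) A = A" "block_diag A (0\<^sub>m 0 0) = A"
  by (rule eq_matI; simp add: block_diag_def)+

lemma sum_lessThan_add:
  "(\<Sum>i<m + n. f i) = (\<Sum>i<m. f i) + (\<Sum>i<n. f (m + i) :: 'a::comm_monoid_add)" for m n :: nat
  by (induction n) (simp_all add: add.assoc)

lemma entry_norm_block_diag: "entry_norm (block_diag A B) = entry_norm A + entry_norm B"
  by (simp add: entry_norm_def block_diag_def sum_lessThan_add)

lemma block_diag_diff:
  fixes A B C D :: "'a::ring mat"
  assumes "A \<in> carrier_mat m n" "C \<in> carrier_mat m n" "B \<in> carrier_mat m' n'" "D \<in> carrier_mat m' n'"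
  shows "block_diag A B - block_diag C D = block_diag (A - C) (B - D)"
  using assms by (intro eq_matI) (auto simp: block_diag_def)

lemma cuntz_le_block_diag:
  fixes A B :: "'a::unital_cstar_algebra mat"
  assumes "cuntz_le A B" "cuntz_le A' B'"
  shows "cuntz_le (block_diag A A') (block_diag B B')"
  unfolding cuntz_le_iff
proof (intro allI impI)
  fix e :: real assume "0 < e"
  then have e2: "0 < e / 2" by simp
  obtain C D where C: "C \<in> carrier_mat (dim_row A) (dim_row B)"
      and D: "D \<in> carrier_mat (dim_col B) (dim_col A)" and CD: "entry_norm (C * B * D - A) < e / 2"
    using assms(1) e2 unfolding cuntz_le_iff by meson
  obtain C' D' where C': "C' \<in> carrier_mat (dim_row A') (dim_row B')"
      and D': "D' \<in> carrier_mat (dim_col B') (dim_col A')" and CD': "entry_norm (C' * B' * D' - A') < e / 2"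
    using assms(2) e2 unfolding cuntz_le_iff by meson
  have B: "B \<in> carrier_mat (dim_row B) (dim_col B)" "B' \<in> carrier_mat (dim_row B') (dim_col B')"
    and A: "A \<in> carrier_mat (dim_row A) (dim_col A)" "A' \<in> carrier_mat (dim_row A') (dim_col A')"
    by auto
  have "block_diag C C' * block_diag B B' * block_diag D D' - block_diag A A' =
      block_diag (C * B * D - A) (C' * B' * D' - A')"
    unfolding block_diag_mult[OF C B(1) C' B(2)]
      block_diag_mult[OF mult_carrier_mat[OF C B(1)] D mult_carrier_mat[OF C' B(2)] D']
    by (rule block_diag_diff[OF mult_carrier_mat[OF mult_carrier_mat[OF C B(1)] D] A(1)
        mult_carrier_mat[OF mult_carrier_mat[OF C' B(2)] D'] A(2)])
  then have "entry_norm (block_diag C C' * block_diag B B' * block_diag D D' - block_diag A A') < e"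
    using CD CD' by (simp add: entry_norm_block_diag)
  then show "\<exists>C\<in>carrier_mat (dim_row (block_diag A A')) (dim_row (block_diag B B')).
      \<exists>D\<in>carrier_mat (dim_col (block_diag B B')) (dim_col (block_diag A A')).
        entry_norm (C * block_diag B B' * D - block_diag A A') < e"
    using block_diag_carrier[OF C C'] block_diag_carrier[OF D D'] by auto
qed

lemma cuntz_le_block_diag_commute:
  "cuntz_le (block_diag A B) (block_diag B A)" for A B :: "'a::unital_cstar_algebra mat"
proof -
  \<comment> \<open>Block permutation matrices, which exchange the two blocks from the left and from
    the right.\<close>
  define P :: "nat \<Rightarrow> nat \<Rightarrow> 'a mat" where "P m n = four_block_mat (0\<^sub>m m n) (1\<^sub>m m) (1\<^sub>m n) (0\<^sub>m n m)" for m n :: nat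
  have P: "P m n \<in> carrier_mat (m + n) (n + m)" for m n by (auto simp: P_def)
  define ar ac br bc where dims: "ar = dim_row A" "ac = dim_col A" "br = dim_row B" "bc = dim_col B"
  have A: "A \<in> carrier_mat ar ac" and B: "B \<in> carrier_mat br bc" by (auto simp: dims)
  have "P ar br * block_diag B A =
      four_block_mat (0\<^sub>m ar br * B + 1\<^sub>m ar * 0\<^sub>m ar bc) (0\<^sub>m ar br * 0\<^sub>m br ac + 1\<^sub>m ar * A)
        (1\<^sub>m br * B + 0\<^sub>m br ar * 0\<^sub>m ar bc) (1\<^sub>m br * 0\<^sub>m br ac + 0\<^sub>m br ar * A)"
    unfolding P_def block_diag_def
    using A B by (subst mult_four_block_mat[of _ ar br _ ar _ br _ _ bc _ ac]) auto
  also have "\<dots> = four_block_mat (0\<^sub>m ar bc) A B (0\<^sub>m br ac)"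
    using A B by simp
  also have "\<dots> * P bc ac = 
      four_block_mat (0\<^sub>m ar bc * 0\<^sub>m bc ac + A * 1\<^sub>m ac) (0\<^sub>m ar bc * 1\<^sub>m bc + A * 0\<^sub>m ac bc)
        (B * 0\<^sub>m bc ac + 0\<^sub>m br ac * 1\<^sub>m ac) (B * 1\<^sub>m bc + 0\<^sub>m br ac * 0\<^sub>m ac bc)"
    unfolding P_def
    using A B by (subst mult_four_block_mat[of _ ar bc _ ac _ br _ _ ac _ bc]) auto
  also have "\<dots> = block_diag A B" using A B by (simp add: block_diag_def)
  finally have eq: "P ar br * block_diag B A * P bc ac = block_diag A B" .
  show ?thesis
    using cuntz_le_factor[of "P ar br" "ar + br" "block_diag B A" "P bc ac" "ac + bc"] P
    unfolding eq by (simp add: dims)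
qed

lemma cuntz_le_block_diag_left: "cuntz_le A (block_diag A B)" for A B :: "'a::unital_cstar_algebra mat"
proof -
  define ar ac br bc where dims: "ar = dim_row A" "ac = dim_col A" "br = dim_row B" "bc = dim_col B"
  \<comment> \<open>\<open>C\<close> and \<open>D\<close> are the projection to, and the inclusion
    of, the leading coordinates.\<close>
  define C :: "'a mat" where "C = mat ar (ar + br) (\<lambda>(i, j). if i = j then 1 else 0)"
  define D :: "'a mat" where "D = mat (ac + bc) ac (\<lambda>(i, j). if i = j then 1 else 0)"
  have "C * block_diag A B * D = A"
  proof (rule eq_matI)
    fix i j assume "i < dim_row A" "j < dim_col A"
    then have ij: "i < ar" "j < ac" by (simp_all add: dims)
    have CB: "(C * block_diag A B) $$ (i, k) = block_diag A B $$ (i, k)" if "k < ac + bc" for k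
    proof -
      have "(C * block_diag A B) $$ (i, k) = (\<Sum>l<ar + br. C $$ (i, l) * block_diag A B $$ (l, k))"
        using ij that by (simp add: C_def scalar_prod_def lessThan_atLeast0 dims)
      also have "\<dots> = (\<Sum>l<ar + br. if l = i then block_diag A B $$ (i, k) else 0)"
        using ij by (intro sum.cong) (auto simp: C_def)
      finally show ?thesis using ij by simp
    qed
    have "(C * block_diag A B * D) $$ (i, j) = (\<Sum>k<ac + bc. (C * block_diag A B) $$ (i, k) * D $$ (k, j))"
      using ij by (simp add: C_def D_def scalar_prod_def lessThan_atLeast0 dims)
    also have "\<dots> = (\<Sum>k<ac + bc. if k = j then block_diag A B $$ (i, j) else 0)"
      using ij by (intro sum.cong) (auto simp: D_def CB)
    also have "\<dots> = A $$ (i, j)" using ij by (simp add: block_diag_def dims)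
    finally show "(C * block_diag A B * D) $$ (i, j) = A $$ (i, j)" .
  qed (simp_all add: C_def D_def dims)
  then show ?thesis
    using cuntz_le_factor[of C ar "block_diag A B" D ac] by (simp add: C_def D_def dims)
qed

definition cuntz_equiv :: "'a::unital_cstar_algebra mat \<Rightarrow> 'a mat \<Rightarrow> bool" where
  "cuntz_equiv A B \<longleftrightarrow> cuntz_le A B \<and> cuntz_le B A"

lemma equivp_cuntz_equiv: "equivp cuntz_equiv"
  by (rule equivpI)
     (auto simp: reflp_def symp_def transp_def cuntz_equiv_def intro: cuntz_le_refl cuntz_le_trans)

text \<open>Unlike in the original semigroup, degenerate matrices are included here. This adds no new
  classes, as they are equivalent to the \<open>1 \<times> 1\<close> zero matrix, but it makes the
  \<open>0 \<times> 0\<close> matrix available as a strict unit for block sums.\<close>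

quotient_type (overloaded) 'a cuntz = "'a::unital_cstar_algebra mat" / cuntz_equiv
  morphisms rep_cuntz cls
  by (rule equivp_cuntz_equiv)

instantiation cuntz :: (unital_cstar_algebra) ordered_comm_monoid_add
begin

lift_definition zero_cuntz :: "'a cuntz" is "0\<^sub>m 0 0" .

lift_definition plus_cuntz :: "'a cuntz \<Rightarrow> 'a cuntz \<Rightarrow> 'a cuntz" is block_diag
  by (auto simp: cuntz_equiv_def cuntz_le_block_diag)

lift_definition less_eq_cuntz :: "'a cuntz \<Rightarrow> 'a cuntz \<Rightarrow> bool" is cuntz_le
  by (meson cuntz_equiv_def cuntz_le_trans)

definition less_cuntz :: "'a cuntz \<Rightarrow> 'a cuntz \<Rightarrow> bool" where
  "less_cuntz x y \<longleftrightarrow> x \<le> y \<and> \<not> y \<le> x"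

instance
proof
  fix a b c :: "'a cuntz"
  show "a + b + c = a + (b + c)"
    by transfer (simp add: block_diag_assoc cuntz_equiv_def cuntz_le_refl)
  show "a + b = b + a"
    by transfer (simp add: cuntz_equiv_def cuntz_le_block_diag_commute)
  show "0 + a = a"
    by transfer (simp add: cuntz_equiv_def cuntz_le_refl)
  show "(a < b) = (a \<le> b \<and> \<not> b \<le> a)" by (rule less_cuntz_def)
  show "a \<le> a" by transfer (rule cuntz_le_refl)
  show "a \<le> c" if "a \<le> b" "b \<le> c" using that by transfer (rule cuntz_le_trans)
  show "a = b" if "a \<le> b" "b \<le> a" using that by transfer (simp add: cuntz_equiv_def)
  show "c + a \<le> c + b" if "a \<le> b"
    using that by transfer (simp add: cuntz_le_block_diag cuntz_le_refl)
qed

end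

lemma cuntz_nonneg: "0 \<le> (a :: 'a::unital_cstar_algebra cuntz)"
proof transfer
  show "cuntz_le (0\<^sub>m 0 0) A" for A :: "'a mat"
    using cuntz_le_block_diag_left[of "0\<^sub>m 0 0" A] by simp
qed

lemma cls_block_diag: "cls (block_diag A B) = cls A + cls B"
  by (simp add: plus_cuntz.abs_eq)

lemma cls_le_iff: "cls A \<le> cls B \<longleftrightarrow> cuntz_le A B"
  by (simp add: less_eq_cuntz.abs_eq)

lemma cls_eq_iff: "cls A = cls B \<longleftrightarrow> cuntz_le A B \<and> cuntz_le B A"
  by (metis cls_le_iff order_antisym order_refl)

text \<open>A zero matrix of any size factors through the \<open>0 \<times> 0\<close> matrix with
  empty factors. This identifies the strict unit with the class of \<open>0\<^sub>m 1 1\<close> at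
  which \<open>cuntz_multiple\<close> starts.\<close>

lemma cls_zero: "cls (0\<^sub>m m n) = (0 :: 'a::unital_cstar_algebra cuntz)"
proof (rule order_antisym)
  have "0\<^sub>m m 0 * (0\<^sub>m 0 0 :: 'a mat) * 0\<^sub>m 0 n = 0\<^sub>m m n"
    by (intro eq_matI) (auto simp: scalar_prod_def)
  then have "cuntz_le (0\<^sub>m m n) (0\<^sub>m 0 0 :: 'a mat)"
    using cuntz_le_factor[of "0\<^sub>m m 0" m "0\<^sub>m 0 0 :: 'a mat" "0\<^sub>m 0 n" n] by simp
  then show "cls (0\<^sub>m m n) \<le> (0 :: 'a cuntz)"
    unfolding zero_cuntz_def cls_le_iff by simp
qed (rule cuntz_nonneg)

section \<open>States on ordered monoids with order unit\<close>

primrec multiple :: "nat \<Rightarrow> 'b::comm_monoid_add \<Rightarrow> 'b" (infixr "\<odot>" 75) where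
  "0 \<odot> v = 0"
| "Suc n \<odot> v = n \<odot> v + v"

lemma multiple_one [simp]: "1 \<odot> v = v" "Suc 0 \<odot> v = v"
  by simp_all

lemma multiple_zero [simp]: "n \<odot> 0 = 0"
  by (induction n) simp_all

lemma multiple_add_left: "(m + n) \<odot> v = m \<odot> v + n \<odot> v"
  by (induction n) (simp_all add: add.assoc)

lemma multiple_add_right: "n \<odot> (v + w) = n \<odot> v + n \<odot> w"
  by (induction n) (simp_all add: ac_simps)

lemma multiple_multiple: "m \<odot> n \<odot> v = (m * n) \<odot> v"
  by (induction m) (simp_all add: multiple_add_left add.commute)

lemma multiple_mono: "v \<le> w \<Longrightarrow> n \<odot> v \<le> n \<odot> w" for v w :: "'b::ordered_comm_monoid_add"
  by (induction n) (simp_all add: add_mono)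

lemma le_Inf_add_Inf:
  fixes A B :: "real set"
  assumes "A \<noteq> {}" "B \<noteq> {}" "\<And>s t. s \<in> A \<Longrightarrow> t \<in> B \<Longrightarrow> c \<le> s + t"
  shows "c \<le> Inf A + Inf B"
proof -
  have "c - t \<le> Inf A" if "t \<in> B" for t
    using assms that by (intro cInf_greatest) (auto simp: diff_le_eq)
  then have "c - Inf A \<le> Inf B"
    using assms by (intro cInf_greatest) (auto simp: algebra_simps)
  then show ?thesis by simp
qed

lemma nonpos_if_multiples_bounded:
  fixes p K :: real
  assumes "\<And>n::nat. real n * p \<le> K"
  shows "p \<le> 0"
  by (metis assms not_le reals_Archimedean3)

text \<open>Fekete's lemma: the limit is the infimum of the quotients. A nearly optimal
  \<open>m\<close> bounds all large \<open>n\<close> by division with remainder.\<close>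

lemma subadditive_limit:
  fixes a :: "nat \<Rightarrow> real"
  assumes nonneg: "\<And>n. 0 \<le> a n" and sub: "\<And>m n. a (m + n) \<le> a m + a n"
  obtains L where "(\<lambda>n. a n / real n) \<longlonglongrightarrow> L" "\<And>n. 1 \<le> n \<Longrightarrow> L * real n \<le> a n"
proof -
  define L where "L = Inf ((\<lambda>n. a n / real n) ` {1..})"
  have bdd: "bdd_below ((\<lambda>n. a n / real n) ` {1..})"
    using nonneg by (intro bdd_belowI2[where m = 0]) simp
  have le: "L \<le> a n / real n" if "1 \<le> n" for n
    unfolding L_def using that bdd by (intro cInf_lower) auto
  have "(\<lambda>n. a n / real n) \<longlonglongrightarrow> L"
  proof (rule LIMSEQ_I)
    fix e :: real assume e: "0 < e"
    then obtain m where m: "1 \<le> m" "a m / real m < L + e / 2"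
      using cInf_lessD[of "(\<lambda>n. a n / real n) ` {1..}" "L + e / 2"] unfolding L_def by auto
    \<comment> \<open>A bound for \<open>a r\<close> at every remainder \<open>r < m\<close>, since
      all terms are nonnegative.\<close>
    define C where "C = (\<Sum>r<m. a r)"
    have mult: "a (q * m + r) \<le> real q * a m + a r" for q r
    proof (induction q)
      case (Suc q)
      then show ?case using sub[of m "q * m + r"] by (simp add: algebra_simps)
    qed simp
    obtain n0 :: nat where n0: "2 * C / e < real n0" using reals_Archimedean2 by blast
    show "\<exists>no. \<forall>n\<ge>no. norm (a n / real n - L) < e"
    proof (intro exI allI impI)
      fix n assume n: "max 1 n0 \<le> n"
      have "a n \<le> real (n div m) * a m + a (n mod m)"
        using mult[of "n div m" "n mod m"] by simp
      also have "a (n mod m) \<le> C"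
        unfolding C_def using m nonneg by (intro member_le_sum) auto
      also have "real (n div m) * a m \<le> real n * (a m / real m)"
      proof -
        have "real (n div m) * real m \<le> real n"
          using div_times_less_eq_dividend[of n m] by (simp flip: of_nat_mult)
        then have "real (n div m) \<le> real n / real m" using m by (simp add: field_simps)
        from mult_right_mono[OF this nonneg[of m]] show ?thesis by (simp add: mult.commute)
      qed
      also have "real n * (a m / real m) \<le> real n * (L + e / 2)"
        using m by (intro mult_left_mono) auto
      finally have "a n / real n \<le> L + e / 2 + C / real n"
        using n by (simp add: field_simps)
      also have "C / real n < e / 2"
      proof -
        have "2 * C / e < real n" using n n0 by simp
        then show ?thesis using e n by (simp add: field_simps)
      qed
      finally have "a n / real n < L + e" by simp
      then show "norm (a n / real n - L) < e"
        using le[of n] n e by (simp add: abs_less_iff)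
    qed
  qed
  moreover have "L * real n \<le> a n" if "1 \<le> n" for n
    using le[OF that] that by (simp add: field_simps)
  ultimately show thesis by (rule that)
qed

section \<open>Growth rates of the two counts\<close>

locale monoid_with_unit =
  fixes u x :: "'b::ordered_comm_monoid_add"
  assumes nonneg: "0 \<le> (v :: 'b)"
    and order_unit: "\<exists>r. (v :: 'b) \<le> r \<odot> u"
    and unit_le_multiple: "\<exists>n. u \<le> n \<odot> x"
    and unit_finite: "s \<odot> u \<le> r \<odot> u \<Longrightarrow> s \<le> r"
begin

lemma multiple_le_mono: "m \<le> n \<Longrightarrow> m \<odot> v \<le> n \<odot> v" for v :: 'b
  using add_left_mono[OF nonneg[of "(n - m) \<odot> v"], of "m \<odot> v"]
  by (simp flip: multiple_add_left)

lemma le_add_right: "v \<le> w + v" for v w :: 'b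
  using add_left_mono[OF nonneg[of w], of v] by (simp add: add.commute)

text \<open>Literally the shape of \<open>lower_count\<close>, including the condition
  \<open>1 \<le> s\<close>, so that the two are identified by rewriting alone; likewise for
  \<open>upper\<close>.\<close>

definition lower :: "nat \<Rightarrow> nat" where
  "lower n = Sup {s. 1 \<le> s \<and> s \<odot> u \<le> n \<odot> x}"

definition upper :: "nat \<Rightarrow> nat" where
  "upper n = Inf {r. 1 \<le> r \<and> n \<odot> x \<le> r \<odot> u}"

lemma lower_bounded: "\<exists>K. \<forall>n s. s \<odot> u \<le> n \<odot> x \<longrightarrow> s \<le> n * K"
proof -
  obtain K where "x \<le> K \<odot> u" using order_unit by blast
  then have "n \<odot> x \<le> (n * K) \<odot> u" for n
    using multiple_mono by (metis multiple_multiple)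
  then show ?thesis using unit_finite order_trans by blast
qed

lemma le_lower_iff: "s \<le> lower n \<longleftrightarrow> s \<odot> u \<le> n \<odot> x"
\<comment> \<open>For \<open>s = 0\<close> both sides hold, in agreement with the supremum 0 of the
  empty set. For other \<open>s\<close> the left side makes \<open>lower n\<close> nonzero, so the
  set is nonempty and its maximum is attained.\<close>
proof (cases "s = 0")
  case False
  let ?S = "{s. 1 \<le> s \<and> s \<odot> u \<le> n \<odot> x}"
  have fin: "finite ?S"
    using lower_bounded by (metis (no_types, lifting) finite_nat_set_iff_bounded_le mem_Collect_eq)
  show ?thesis
  proof
    assume "s \<le> lower n"
    then have "lower n \<noteq> 0" using False by simp
    then have "?S \<noteq> {}" unfolding lower_def Sup_nat_def by metis
    then have "lower n \<in> ?S"
      using Max_in[OF fin] by (simp add: lower_def Sup_nat_def)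
    then show "s \<odot> u \<le> n \<odot> x"
      using multiple_le_mono[OF \<open>s \<le> lower n\<close>] order_trans by blast
  next
    assume "s \<odot> u \<le> n \<odot> x"
    then show "s \<le> lower n"
      unfolding lower_def using False fin by (intro cSup_upper) (auto simp: bdd_above_nat)
  qed
qed (simp add: nonneg)

lemma upper_mem: "1 \<le> upper n" "n \<odot> x \<le> upper n \<odot> u"
proof -
  obtain r where "n \<odot> x \<le> r \<odot> u" using order_unit by blast
  \<comment> \<open>The successor is taken because the set excludes 0.\<close>
  then have "n \<odot> x \<le> Suc r \<odot> u" using multiple_le_mono[of r "Suc r" u] order_trans by fastforce
  then have "{r. 1 \<le> r \<and> n \<odot> x \<le> r \<odot> u} \<noteq> {}" by (auto intro!: exI[of _ "Suc r"])
  then have "upper n \<in> {r. 1 \<le> r \<and> n \<odot> x \<le> r \<odot> u}"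
    unfolding upper_def by (rule Inf_nat_def1)
  then show "1 \<le> upper n" "n \<odot> x \<le> upper n \<odot> u" by auto
qed

lemma upper_le: "1 \<le> r \<Longrightarrow> n \<odot> x \<le> r \<odot> u \<Longrightarrow> upper n \<le> r"
  unfolding upper_def by (rule wellorder_Inf_le1) simp

text \<open>\<open>lower\<close> is superadditive and at most \<open>n * K\<close>, so
  \<open>n * K - lower n\<close> is nonnegative and subadditive and Fekete's lemma applies to
  it.\<close>

lemma lower_limit:
  obtains L where "(\<lambda>n. real (lower n) / real n) \<longlonglongrightarrow> L" "0 \<le> L" "\<And>n. real (lower n) \<le> L * real n"
proof -
  obtain K where K: "lower n \<le> n * K" for n using lower_bounded le_lower_iff by (meson order_refl)
  have super: "lower m + lower n \<le> lower (m + n)" for m n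
    using le_lower_iff[of "lower m" m] le_lower_iff[of "lower n" n]
    by (simp add: le_lower_iff multiple_add_left add_mono)
  have K': "real (lower n) \<le> real n * real K" for n
    using K[of n] by (simp flip: of_nat_mult)
  have super': "real (lower m) + real (lower n) \<le> real (lower (m + n))" for m n
    using super[of m n] by (simp flip: of_nat_add)
  obtain L where L: "(\<lambda>n. (real n * real K - real (lower n)) / real n) \<longlonglongrightarrow> L"
      "\<And>n. 1 \<le> n \<Longrightarrow> L * real n \<le> real n * real K - real (lower n)"
    by (rule subadditive_limit[of "\<lambda>n. real n * real K - real (lower n)"])
       (use K' super' in \<open>auto simp: algebra_simps\<close>)
  have lim: "(\<lambda>n. real (lower n) / real n) \<longlonglongrightarrow> real K - L"
  proof (rule Lim_transform_eventually)
    show "(\<lambda>n. real K - (real n * real K - real (lower n)) / real n) \<longlonglongrightarrow> real K - L"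
      by (intro tendsto_intros L)
    show "\<forall>\<^sub>F n in sequentially. real K - (real n * real K - real (lower n)) / real n =
        real (lower n) / real n"
      using eventually_gt_at_top[of 0] by eventually_elim (simp add: field_simps)
  qed
  show thesis
  proof (rule that[OF lim])
    show "0 \<le> real K - L" by (rule LIMSEQ_le_const[OF lim]) simp
    show "real (lower n) \<le> (real K - L) * real n" for n
      using L(2)[of n] K[of n] by (cases "n = 0") (auto simp: algebra_simps)
  qed
qed

lemma upper_limit:
  obtains L where "(\<lambda>n. real (upper n) / real n) \<longlonglongrightarrow> L" "\<And>n. 1 \<le> n \<Longrightarrow> L * real n \<le> real (upper n)"
proof (rule subadditive_limit[of "\<lambda>n. real (upper n)"])
  show "real (upper (m + n)) \<le> real (upper m) + real (upper n)" for m n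
  proof -
    have "upper (m + n) \<le> upper m + upper n"
      using upper_mem[of m] upper_mem[of n]
      by (intro upper_le) (simp_all add: multiple_add_left add_mono)
    then show ?thesis by (simp flip: of_nat_add)
  qed
qed (auto intro: that)

text \<open>The term \<open>z\<close> acts as a catalyst: in its presence the copies of
  \<open>v\<close> are exchanged for copies of \<open>w\<close> one at a time. At the end it is
  dropped on the left and bounded by \<open>R \<odot> u\<close> on the right, at a cost independent
  of \<open>M\<close>.\<close>

lemma cancel:
  assumes "z + v \<le> z + w"
  obtains R where "\<And>M. M \<odot> v \<le> M \<odot> w + R \<odot> u"
proof -
  have iter: "z + M \<odot> v \<le> z + M \<odot> w" for M
  proof (induction M)
    case (Suc M)
    have "z + Suc M \<odot> v \<le> (z + M \<odot> w) + v"
      using add_right_mono[OF Suc, of v] by (simp add: ac_simps)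
    also have "\<dots> \<le> M \<odot> w + (z + w)"
      using add_left_mono[OF assms, of "M \<odot> w"] by (simp add: ac_simps)
    finally show ?case by (simp add: ac_simps)
  qed simp
  obtain R where R: "z \<le> R \<odot> u" using order_unit by blast
  have "M \<odot> v \<le> M \<odot> w + R \<odot> u" for M
  proof -
    have "M \<odot> v \<le> z + M \<odot> v" by (rule le_add_right)
    also have "\<dots> \<le> z + M \<odot> w" by (rule iter)
    also have "\<dots> \<le> R \<odot> u + M \<odot> w" by (rule add_right_mono[OF R])
    finally show ?thesis by (simp add: add.commute)
  qed
  then show thesis by (rule that)
qed

end

section \<open>Extension of a prescribed value to a state\<close>

locale monoid_with_value = monoid_with_unit u x for u x :: "'b::ordered_comm_monoid_add" +
  fixes \<alpha> :: real
  assumes \<alpha>_nonneg: "0 \<le> \<alpha>"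
    and lower_le: "real (lower n) \<le> \<alpha> * real n"
    and le_upper: "1 \<le> n \<Longrightarrow> \<alpha> * real n \<le> real (upper n)"
begin

text \<open>Common multiples of \<open>u\<close> and \<open>x\<close> are removed by
  \<open>cancel\<close>, which leaves four sign patterns. Multiples of \<open>x\<close> below
  multiples of \<open>u\<close> are governed by \<open>upper\<close>, the reverse by
  \<open>lower\<close>; a positive multiple of \<open>u\<close> left over against nothing
  contradicts \<open>unit_finite\<close>; the last pattern is termwise monotonicity.\<close>

lemma value_consistent:
  assumes le: "c \<odot> u + d \<odot> x \<le> a \<odot> u + b \<odot> x"
  shows "real c + real d * \<alpha> \<le> real a + real b * \<alpha>"
proof -
  consider (1) d' e where "d = b + d'" "a = c + e" | (2) d' c' where "d = b + d'" "c = a + Suc c'"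
    | (3) b' c' where "b = d + b'" "c = a + c'" | (4) "d \<le> b" "c \<le> a"
    by (metis le_add_diff_inverse less_imp_Suc_add nat_le_linear not_le add_Suc_right)
  then show ?thesis
  proof cases
    case 1
    have "(c \<odot> u + b \<odot> x) + d' \<odot> x \<le> (c \<odot> u + b \<odot> x) + e \<odot> u"
      using le by (simp add: 1 multiple_add_left ac_simps)
    then obtain R where R: "\<And>M. M \<odot> d' \<odot> x \<le> M \<odot> e \<odot> u + R \<odot> u" by (rule cancel) blast
    \<comment> \<open>The summand 1 makes the bound for \<open>upper\<close> admissible, as
      candidates must be at least 1. The case \<open>M * d' = 0\<close> is separate because
      \<open>le_upper\<close> starts at 1.\<close>
    have "real M * (real d' * \<alpha> - real e) \<le> real R + 1" for M
    proof (cases "M * d' = 0")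
      case False
      have "(M * d') \<odot> x \<le> (M * e + R) \<odot> u"
        using R[of M] by (simp add: multiple_multiple multiple_add_left)
      also have "\<dots> \<le> (M * e + R + 1) \<odot> u" by (rule multiple_le_mono) simp
      finally have "upper (M * d') \<le> M * e + R + 1" by (intro upper_le) simp_all
      then have "real (upper (M * d')) \<le> real M * real e + real R + 1"
        by (metis of_nat_1 of_nat_add of_nat_le_iff of_nat_mult)
      then show ?thesis using le_upper[of "M * d'"] False by (simp add: algebra_simps)
    next
      case True
      then have "real M * (real d' * \<alpha>) = 0" by auto
      moreover have "0 \<le> real M * real e" by simp
      ultimately show ?thesis unfolding right_diff_distrib by linarith
    qed
    then have "real d' * \<alpha> - real e \<le> 0" by (rule nonpos_if_multiples_bounded)
    then show ?thesis by (simp add: 1 algebra_simps)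
  next
    case 2
    have "(a \<odot> u + b \<odot> x) + (d' \<odot> x + Suc c' \<odot> u) \<le> (a \<odot> u + b \<odot> x) + 0"
      using le by (simp add: 2 multiple_add_left ac_simps)
    then obtain R where R: "\<And>M. M \<odot> (d' \<odot> x + Suc c' \<odot> u) \<le> M \<odot> 0 + R \<odot> u" by (rule cancel) blast
    \<comment> \<open>\<open>M = Suc R\<close> copies exceed the error \<open>R\<close>, whatever
      \<open>c'\<close> is.\<close>
    have "Suc R \<odot> Suc c' \<odot> u \<le> R \<odot> u"
      using order_trans[OF multiple_mono[OF le_add_right] R[of "Suc R"]] by simp
    then have "Suc R * Suc c' \<le> R" by (intro unit_finite) (simp only: multiple_multiple)
    then show ?thesis by simp
  next
    case 3
    obtain N where N: "u \<le> N \<odot> x" using unit_le_multiple by blast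
    have "(a \<odot> u + d \<odot> x) + c' \<odot> u \<le> (a \<odot> u + d \<odot> x) + b' \<odot> x"
      using le by (simp add: 3 multiple_add_left ac_simps)
    then obtain R where R: "\<And>M. M \<odot> c' \<odot> u \<le> M \<odot> b' \<odot> x + R \<odot> u" by (rule cancel) blast
    \<comment> \<open>\<open>lower\<close> compares with multiples of \<open>x\<close> only, so the
      error \<open>R \<odot> u\<close> is first replaced by
      \<open>(R * N) \<odot> x\<close>.\<close>
    have "real M * (real c' - real b' * \<alpha>) \<le> real R * real N * \<alpha>" for M
    proof -
      have "(M * c') \<odot> u \<le> (M * b' + R * N) \<odot> x"
        using order_trans[OF R[of M] add_left_mono[OF multiple_mono[OF N]]]
        by (simp add: multiple_multiple multiple_add_left)
      then have "M * c' \<le> lower (M * b' + R * N)" by (simp add: le_lower_iff)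
      then have "real (M * c') \<le> \<alpha> * real (M * b' + R * N)"
        using lower_le by (meson of_nat_le_iff order_trans)
      then show ?thesis by (simp add: algebra_simps)
    qed
    then have "real c' - real b' * \<alpha> \<le> 0" by (rule nonpos_if_multiples_bounded)
    then show ?thesis by (simp add: 3 algebra_simps)
  next
    case 4
    then show ?thesis using \<alpha>_nonneg by (intro add_mono mult_right_mono) auto
  qed
qed

text \<open>Together with subadditivity, the last four clauses say that adding \<open>u\<close> or
  \<open>x\<close> raises \<open>p\<close> by exactly 1 or \<alpha>. They are stated as one-sided
  inequalities because these pass to infima of chains.\<close>

definition sublinear_state :: "('b \<Rightarrow> real) \<Rightarrow> bool" where
  "sublinear_state p \<longleftrightarrow>
     (\<forall>v. 0 \<le> p v) \<and> (\<forall>v w. v \<le> w \<longrightarrow> p v \<le> p w) \<and> (\<forall>v w. p (v + w) \<le> p v + p w) \<and>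
     (\<forall>n v. real n * p v \<le> p (n \<odot> v)) \<and>
     p u \<le> 1 \<and> (\<forall>v. p v + 1 \<le> p (v + u)) \<and> p x \<le> \<alpha> \<and> (\<forall>v. p v + \<alpha> \<le> p (v + x))"

lemma sublinear_stateD:
  assumes "sublinear_state p"
  shows "0 \<le> p v" "v \<le> w \<Longrightarrow> p v \<le> p w" "p (v + w) \<le> p v + p w" "real n * p v \<le> p (n \<odot> v)"
    "p u \<le> 1" "p v + 1 \<le> p (v + u)" "p x \<le> \<alpha>" "p v + \<alpha> \<le> p (v + x)"
  using assms by (simp_all add: sublinear_state_def)

text \<open>Each element is an upper bound that an inequality forces on the value at
  \<open>v\<close> of every state sending \<open>u\<close> to 1 and \<open>x\<close> to \<alpha>.
  The terms with \<open>c\<close> and \<open>d\<close> stand in for subtraction, which makes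
  translation by \<open>u\<close> and \<open>x\<close> exact; the denominator \<open>n\<close> gives
  \<open>n p(v) \<le> p(n v)\<close> for the infimum \<open>p\<close>.\<close>

definition dominating_values :: "'b \<Rightarrow> real set" where
  "dominating_values v = {(real a - real c + (real b - real d) * \<alpha>) / real n | n a b c d.
     1 \<le> n \<and> n \<odot> v + c \<odot> u + d \<odot> x \<le> a \<odot> u + b \<odot> x}"

lemma dominating_valuesI:
  assumes "1 \<le> n" "n \<odot> v + c \<odot> u + d \<odot> x \<le> a \<odot> u + b \<odot> x"
    "t = (real a - real c + (real b - real d) * \<alpha>) / real n"
  shows "t \<in> dominating_values v"
  using assms unfolding dominating_values_def by blast

lemma dominating_valuesE:
  assumes "t \<in> dominating_values v"
  obtains n a b c d where "1 \<le> n" "n \<odot> v + c \<odot> u + d \<odot> x \<le> a \<odot> u + b \<odot> x"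
    "t = (real a - real c + (real b - real d) * \<alpha>) / real n"
  using assms unfolding dominating_values_def by blast

text \<open>Dropping \<open>n \<odot> v\<close> leaves an inequality between combinations of
  \<open>u\<close> and \<open>x\<close>. This is where the choice of \<alpha> between the two limits
  enters.\<close>

lemma dominating_values_nonneg: "t \<in> dominating_values v \<Longrightarrow> 0 \<le> t"
proof (erule dominating_valuesE)
  fix n a b c d
  assume n: "1 \<le> n" "n \<odot> v + c \<odot> u + d \<odot> x \<le> a \<odot> u + b \<odot> x"
    and t: "t = (real a - real c + (real b - real d) * \<alpha>) / real n"
  have "c \<odot> u + d \<odot> x \<le> a \<odot> u + b \<odot> x"
    using order_trans[OF le_add_right n(2)[unfolded add.assoc]] .
  then show "0 \<le> t" using value_consistent n(1) unfolding t by (simp add: algebra_simps)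
qed

lemma dominating_values_nonempty: "dominating_values v \<noteq> {}"
proof -
  obtain r where "v \<le> r \<odot> u" using order_unit by blast
  then have "real r \<in> dominating_values v"
    by (intro dominating_valuesI[of 1 v 0 0 r 0]) auto
  then show ?thesis by blast
qed

lemma dominating_values_add:
  assumes "s \<in> dominating_values v" "t \<in> dominating_values w"
  shows "s + t \<in> dominating_values (v + w)"
proof -
  obtain n a b c d where n: "1 \<le> n" "n \<odot> v + c \<odot> u + d \<odot> x \<le> a \<odot> u + b \<odot> x"
      "s = (real a - real c + (real b - real d) * \<alpha>) / real n"
    using assms(1) by (rule dominating_valuesE)
  obtain n' a' b' c' d' where n': "1 \<le> n'" "n' \<odot> w + c' \<odot> u + d' \<odot> x \<le> a' \<odot> u + b' \<odot> x"
      "t = (real a' - real c' + (real b' - real d') * \<alpha>) / real n'"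
    using assms(2) by (rule dominating_valuesE)
  have le: "n' \<odot> (n \<odot> v + c \<odot> u + d \<odot> x) + n \<odot> (n' \<odot> w + c' \<odot> u + d' \<odot> x) \<le>
      n' \<odot> (a \<odot> u + b \<odot> x) + n \<odot> (a' \<odot> u + b' \<odot> x)"
    by (intro add_mono multiple_mono n n')
  show ?thesis
  proof (rule dominating_valuesI)
    show "1 \<le> n * n'" using n n' by simp
    show "(n * n') \<odot> (v + w) + (n' * c + n * c') \<odot> u + (n' * d + n * d') \<odot> x \<le>
        (n' * a + n * a') \<odot> u + (n' * b + n * b') \<odot> x"
      using le by (simp add: multiple_add_right multiple_add_left multiple_multiple ac_simps)
    show "s + t = (real (n' * a + n * a') - real (n' * c + n * c') +
        (real (n' * b + n * b') - real (n' * d + n * d')) * \<alpha>) / real (n * n')"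
      unfolding n(3) n'(3) using n(1) n'(1) by (simp add: field_simps)
  qed
qed

lemma dominating_values_antimono:
  assumes "v \<le> w" "t \<in> dominating_values w"
  shows "t \<in> dominating_values v"
  using assms(2)
proof (rule dominating_valuesE)
  fix n a b c d
  assume n: "1 \<le> n" "n \<odot> w + c \<odot> u + d \<odot> x \<le> a \<odot> u + b \<odot> x"
    and t: "t = (real a - real c + (real b - real d) * \<alpha>) / real n"
  have "n \<odot> v + c \<odot> u + d \<odot> x \<le> n \<odot> w + c \<odot> u + d \<odot> x"
    by (intro add_right_mono multiple_mono assms)
  then show ?thesis using n t by (intro dominating_valuesI[of n v c d a b]) auto
qed

lemma dominating_values_multiple:
  assumes "1 \<le> k" "t \<in> dominating_values (k \<odot> v)"
  shows "t / real k \<in> dominating_values v"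
  using assms(2)
proof (rule dominating_valuesE)
  fix n a b c d
  assume "1 \<le> n" "n \<odot> k \<odot> v + c \<odot> u + d \<odot> x \<le> a \<odot> u + b \<odot> x"
    "t = (real a - real c + (real b - real d) * \<alpha>) / real n"
  then show ?thesis
    using assms by (intro dominating_valuesI[of "n * k" v c d a b]) (auto simp: multiple_multiple)
qed

lemma dominating_values_diff_unit:
  assumes "t \<in> dominating_values (v + u)"
  shows "t - 1 \<in> dominating_values v"
  using assms
proof (rule dominating_valuesE)
  fix n a b c d
  assume "1 \<le> n" "n \<odot> (v + u) + c \<odot> u + d \<odot> x \<le> a \<odot> u + b \<odot> x"
    "t = (real a - real c + (real b - real d) * \<alpha>) / real n"
  then show ?thesis
    by (intro dominating_valuesI[of n v "n + c" d a b])
       (auto simp: multiple_add_left multiple_add_right ac_simps field_simps)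
qed

lemma dominating_values_diff_x:
  assumes "t \<in> dominating_values (v + x)"
  shows "t - \<alpha> \<in> dominating_values v"
  using assms
proof (rule dominating_valuesE)
  fix n a b c d
  assume "1 \<le> n" "n \<odot> (v + x) + c \<odot> u + d \<odot> x \<le> a \<odot> u + b \<odot> x"
    "t = (real a - real c + (real b - real d) * \<alpha>) / real n"
  then show ?thesis
    by (intro dominating_valuesI[of n v c "n + d" a b])
       (auto simp: multiple_add_left multiple_add_right ac_simps field_simps)
qed

lemma Inf_dominating_values_le: "t \<in> dominating_values v \<Longrightarrow> Inf (dominating_values v) \<le> t"
  by (meson bdd_belowI cInf_lower dominating_values_nonneg)

lemma le_Inf_dominating_values:
  "(\<And>t. t \<in> dominating_values v \<Longrightarrow> c \<le> t) \<Longrightarrow> c \<le> Inf (dominating_values v)"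
  by (rule cInf_greatest[OF dominating_values_nonempty])

lemma sublinear_state_Inf_dominating_values: "sublinear_state (\<lambda>v. Inf (dominating_values v))"
  unfolding sublinear_state_def
proof (intro conjI allI impI)
  show "0 \<le> Inf (dominating_values v)" for v
    by (intro le_Inf_dominating_values dominating_values_nonneg)
  show "Inf (dominating_values v) \<le> Inf (dominating_values w)" if "v \<le> w" for v w
    by (intro le_Inf_dominating_values Inf_dominating_values_le dominating_values_antimono[OF that])
  show "Inf (dominating_values (v + w)) \<le> Inf (dominating_values v) + Inf (dominating_values w)" for v w
    by (intro le_Inf_add_Inf dominating_values_nonempty Inf_dominating_values_le dominating_values_add)
  show "real n * Inf (dominating_values v) \<le> Inf (dominating_values (n \<odot> v))" for n v
  proof (rule le_Inf_dominating_values)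
    fix t assume t: "t \<in> dominating_values (n \<odot> v)"
    show "real n * Inf (dominating_values v) \<le> t"
    proof (cases "n = 0")
      case False
      then show ?thesis
        using Inf_dominating_values_le[OF dominating_values_multiple[OF _ t]] by (simp add: field_simps)
    qed (use dominating_values_nonneg[OF t] in simp)
  qed
  show "Inf (dominating_values u) \<le> 1"
    by (rule Inf_dominating_values_le) (rule dominating_valuesI[of 1 u 0 0 1 0]; simp)
  show "Inf (dominating_values x) \<le> \<alpha>"
    by (rule Inf_dominating_values_le) (rule dominating_valuesI[of 1 x 0 0 0 1]; simp)
  show "Inf (dominating_values v) + 1 \<le> Inf (dominating_values (v + u))" for v
    using Inf_dominating_values_le[OF dominating_values_diff_unit]
    by (intro le_Inf_dominating_values) (simp add: le_diff_eq)
  show "Inf (dominating_values v) + \<alpha> \<le> Inf (dominating_values (v + x))" for v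
    using Inf_dominating_values_le[OF dominating_values_diff_x]
    by (intro le_Inf_dominating_values) (simp add: le_diff_eq)
qed

lemma sublinear_state_chain_Inf:
  assumes C: "C \<noteq> {}" "\<And>p. p \<in> C \<Longrightarrow> sublinear_state p"
    and chain: "\<And>p q. p \<in> C \<Longrightarrow> q \<in> C \<Longrightarrow> p \<le> q \<or> q \<le> p"
  shows "sublinear_state (\<lambda>v. INF p\<in>C. p v)" "\<And>p. p \<in> C \<Longrightarrow> (\<lambda>v. INF p\<in>C. p v) \<le> p"
proof -
  note S = sublinear_stateD[OF C(2)]
  have le: "(INF p\<in>C. p v) \<le> p v" if "p \<in> C" for p v
    using that S(1) by (intro cINF_lower bdd_belowI2[where m = 0])
  have ge: "c \<le> (INF p\<in>C. p v)" if "\<And>p. p \<in> C \<Longrightarrow> c \<le> p v" for c v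
    by (rule cINF_greatest[OF C(1) that])
  show "(\<lambda>v. INF p\<in>C. p v) \<le> p" if "p \<in> C" for p using le[OF that] by (simp add: le_fun_def)
  show "sublinear_state (\<lambda>v. INF p\<in>C. p v)"
    unfolding sublinear_state_def
  proof (intro conjI allI impI)
    show "0 \<le> (INF p\<in>C. p v)" for v by (rule ge) (rule S(1))
    show "(INF p\<in>C. p v) \<le> (INF p\<in>C. p w)" if "v \<le> w" for v w
      by (rule ge) (rule order_trans[OF le S(2)[OF _ that]])
    show "(INF p\<in>C. p (v + w)) \<le> (INF p\<in>C. p v) + (INF p\<in>C. p w)" for v w
    proof (rule le_Inf_add_Inf)
      fix s t assume "s \<in> (\<lambda>p. p v) ` C" "t \<in> (\<lambda>p. p w) ` C"
      then obtain p q where pq: "p \<in> C" "q \<in> C" "s = p v" "t = q w" by auto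
      \<comment> \<open>Subadditivity is the only clause that compares two members of
        \<open>C\<close>, and hence the one that uses comparability.\<close>
      then obtain r where r: "r \<in> C" "r \<le> p" "r \<le> q" using chain by (meson order_refl)
      have "(INF p\<in>C. p (v + w)) \<le> r (v + w)" by (rule le[OF r(1)])
      also have "\<dots> \<le> r v + r w" by (rule S(3)[OF r(1)])
      also have "\<dots> \<le> s + t" using r pq by (auto simp: le_fun_def intro: add_mono)
      finally show "(INF p\<in>C. p (v + w)) \<le> s + t" .
    qed (use C in auto)
    show "real n * (INF p\<in>C. p v) \<le> (INF p\<in>C. p (n \<odot> v))" for n v
    proof (rule ge)
      fix p assume p: "p \<in> C"
      have "real n * (INF p\<in>C. p v) \<le> real n * p v" by (intro mult_left_mono le p) simp
      also have "\<dots> \<le> p (n \<odot> v)" by (rule S(4)[OF p])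
      finally show "real n * (INF p\<in>C. p v) \<le> p (n \<odot> v)" .
    qed
    obtain p where p: "p \<in> C" using C by blast
    show "(INF p\<in>C. p u) \<le> 1" by (rule order_trans[OF le[OF p] S(5)[OF p]])
    show "(INF p\<in>C. p x) \<le> \<alpha>" by (rule order_trans[OF le[OF p] S(7)[OF p]])
    show "(INF p\<in>C. p v) + 1 \<le> (INF p\<in>C. p (v + u))" for v
      by (rule ge) (rule order_trans[OF add_right_mono[OF le] S(6)])
    show "(INF p\<in>C. p v) + \<alpha> \<le> (INF p\<in>C. p (v + x))" for v
      by (rule ge) (rule order_trans[OF add_right_mono[OF le] S(8)])
  qed
qed

text \<open>If \<open>p\<close> is minimal, then it equals \<open>\<lambda>v. INF n. p (v + n \<odot> y) - n * p y\<close>, and so it is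
  superadditive. The infimum is nonnegative because \<open>p (v + n \<odot> y) \<ge> p (n \<odot> y) \<ge> n * p y\<close>.\<close>

lemma sublinear_state_shift:
  fixes y :: 'b
  assumes "sublinear_state p"
  defines "q \<equiv> \<lambda>v. INF n. p (v + n \<odot> y) - real n * p y"
  shows "sublinear_state q" "\<And>v n. q v \<le> p (v + n \<odot> y) - real n * p y"
proof -
  note nn = sublinear_stateD(1)[OF assms(1)] and mono = sublinear_stateD(2)[OF assms(1)]
    and sub = sublinear_stateD(3)[OF assms(1)] and hom = sublinear_stateD(4)[OF assms(1)]
    and pu = sublinear_stateD(5)[OF assms(1)] and pvu = sublinear_stateD(6)[OF assms(1)]
    and px = sublinear_stateD(7)[OF assms(1)] and pvx = sublinear_stateD(8)[OF assms(1)]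
  have term_nonneg: "0 \<le> p (v + n \<odot> y) - real n * p y" for v n
    using hom[of n y] mono[OF le_add_right[of "n \<odot> y" v]] by linarith
  have le: "q v \<le> p (v + n \<odot> y) - real n * p y" for v n
    unfolding q_def by (intro cINF_lower bdd_belowI2[where m = 0] term_nonneg) simp
  have ge: "c \<le> q v" if "\<And>n. c \<le> p (v + n \<odot> y) - real n * p y" for c v
    unfolding q_def by (rule cINF_greatest[OF UNIV_not_empty that])
  show "q v \<le> p (v + n \<odot> y) - real n * p y" for v n by (rule le)
  have p0: "p 0 \<le> 0" using pvu[of 0] pu unfolding add_0 by linarith
  have upper_hom: "p (n \<odot> y) \<le> real n * p y" for n
  proof (induction n)
    case (Suc n)
    then show ?case using sub[of "n \<odot> y" y] by (simp add: algebra_simps)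
  qed (use p0 in simp)
  show "sublinear_state q"
    unfolding sublinear_state_def
  proof (intro conjI allI impI)
    show nq: "0 \<le> q v" for v by (intro ge term_nonneg)
    show "q v \<le> q w" if "v \<le> w" for v w
    proof (rule ge)
      fix n
      show "q v \<le> p (w + n \<odot> y) - real n * p y"
        using le[of v n] mono[OF add_right_mono[OF that, of "n \<odot> y"]] by linarith
    qed
    show "q (v + w) \<le> q v + q w" for v w
    proof -
      have "q (v + w) \<le> (INF n. p (v + n \<odot> y) - real n * p y) + (INF n. p (w + n \<odot> y) - real n * p y)"
      proof (rule le_Inf_add_Inf)
        fix s t
        assume "s \<in> range (\<lambda>n. p (v + n \<odot> y) - real n * p y)" "t \<in> range (\<lambda>n. p (w + n \<odot> y) - real n * p y)"
        then obtain m n where "s = p (v + m \<odot> y) - real m * p y" "t = p (w + n \<odot> y) - real n * p y" by auto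
        then show "q (v + w) \<le> s + t"
          using le[of "v + w" "m + n"] sub[of "v + m \<odot> y" "w + n \<odot> y"]
          by (simp add: multiple_add_left algebra_simps)
      qed auto
      then show ?thesis unfolding q_def .
    qed
    show "real k * q v \<le> q (k \<odot> v)" for k v
    proof (cases k)
      case (Suc j)
      show ?thesis
      proof (rule ge)
        fix m
        \<comment> \<open>The left side has \<open>k * m\<close> copies of \<open>y\<close>, of
          which \<open>m\<close> are wanted. The other \<open>j * m\<close> are split off by
          subadditivity and cost at most \<open>j * m\<close> times \<open>p y\<close>.\<close>
        have eq: "k \<odot> (v + m \<odot> y) = (k \<odot> v + m \<odot> y) + (j * m) \<odot> y"
          by (simp add: Suc multiple_add_right multiple_multiple multiple_add_left ac_simps)
        have "real k * q v \<le> real k * (p (v + m \<odot> y) - real m * p y)"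
          by (intro mult_left_mono le) simp
        also have "\<dots> = real k * p (v + m \<odot> y) - real k * real m * p y" by (simp add: algebra_simps)
        also have "\<dots> \<le> p (k \<odot> v + m \<odot> y) + real (j * m) * p y - real k * real m * p y"
          using hom[of k "v + m \<odot> y"] sub[of "k \<odot> v + m \<odot> y" "(j * m) \<odot> y"] upper_hom[of "j * m"]
          unfolding eq by linarith
        also have "\<dots> = p (k \<odot> v + m \<odot> y) - real m * p y" by (simp add: Suc algebra_simps)
        finally show "real k * q v \<le> p (k \<odot> v + m \<odot> y) - real m * p y" .
      qed
    qed (simp add: nq)
    show "q u \<le> 1" using le[of u 0] pu by simp
    show "q x \<le> \<alpha>" using le[of x 0] px by simp
    show "q v + 1 \<le> q (v + u)" for v
    proof (rule ge)
      show "q v + 1 \<le> p (v + u + n \<odot> y) - real n * p y" for n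
        using le[of v n] pvu[of "v + n \<odot> y"] by (simp add: ac_simps)
    qed
    show "q v + \<alpha> \<le> q (v + x)" for v
    proof (rule ge)
      show "q v + \<alpha> \<le> p (v + x + n \<odot> y) - real n * p y" for n
        using le[of v n] pvx[of "v + n \<odot> y"] by (simp add: ac_simps)
    qed
  qed
qed

theorem exists_state_with_value:
  obtains f where "\<And>v. 0 \<le> f v" "\<And>v w. v \<le> w \<Longrightarrow> f v \<le> f w" "\<And>v w. f (v + w) = f v + f w"
    "f u = 1" "f x = \<alpha>"
proof -
  let ?A = "Collect sublinear_state"
  have "\<exists>p\<in>?A. \<forall>q\<in>?A. q \<le> p \<longrightarrow> q = p"
  \<comment> \<open>The order is reversed, so a maximal element is a minimal functional. The empty
    chain is bounded by the functional built from \<open>dominating_values\<close>.\<close>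
  proof (rule predicate_Zorn[where P = "\<lambda>p q :: 'b \<Rightarrow> real. q \<le> p"])
    show "partial_order_on ?A (relation_of (\<lambda>p q. q \<le> p) ?A)"
      by (rule partial_order_on_relation_ofI) auto
    fix C assume C: "C \<in> Chains (relation_of (\<lambda>p q :: 'b \<Rightarrow> real. q \<le> p) ?A)"
    show "\<exists>u\<in>?A. \<forall>p\<in>C. u \<le> p"
    proof (cases "C = {}")
      case True
      then show ?thesis using sublinear_state_Inf_dominating_values by blast
    next
      case False
      have "sublinear_state p" "p \<le> q \<or> q \<le> p" if "p \<in> C" "q \<in> C" for p q
        using C that unfolding Chains_def relation_of_def by auto
      then show ?thesis using sublinear_state_chain_Inf[OF False] by blast
    qed
  qed
  then obtain p where p: "sublinear_state p" and min: "\<And>q. sublinear_state q \<Longrightarrow> q \<le> p \<Longrightarrow> q = p"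
    by auto
  have sup: "p v + p y \<le> p (v + y)" for v y
  proof -
    note q = sublinear_state_shift[OF p, where y = y]
    have "(\<lambda>v. INF n. p (v + n \<odot> y) - real n * p y) \<le> p"
      using q(2)[where n = 0] by (simp add: le_fun_def)
    then have eq: "(\<lambda>v. INF n. p (v + n \<odot> y) - real n * p y) = p" by (rule min[OF q(1)])
    have "p v \<le> p (v + 1 \<odot> y) - real 1 * p y"
      using q(2)[where v = v and n = 1] unfolding fun_cong[OF eq] .
    then show ?thesis by simp
  qed
  note P = sublinear_stateD[OF p]
  have add: "p (v + w) = p v + p w" for v w using sup[of v w] P(3)[of v w] by simp
  then have p0: "p 0 = 0" using add[of 0 0] by simp
  show thesis
  proof (rule that[of p])
    show "p u = 1" using P(5) P(6)[of 0] p0 by simp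
    show "p x = \<alpha>" using P(7) P(8)[of 0] p0 by simp
  qed (use P(1,2) add in auto)
qed

end

section \<open>The unit of the Cuntz semigroup\<close>

text \<open>Neumann series: \<open>Z n\<close> are the partial sums of the powers of
  \<open>F = 1 - E\<close>. They converge entrywise, and the limit \<open>Y\<close> satisfies
  \<open>1 + F * Y = Y\<close>, which is \<open>E * Y = 1\<close>.\<close>

lemma right_inverse_near_one_mat:
  fixes E :: "'a::{real_normed_algebra_1, banach} mat"
  assumes E: "E \<in> carrier_mat s s" and near: "entry_norm (E - 1\<^sub>m s) < 1"
  obtains Z where "Z \<in> carrier_mat s s" "E * Z = 1\<^sub>m s"
proof -
  define F where "F = 1\<^sub>m s - E"
  define q where "q = entry_norm F"
  have F: "F \<in> carrier_mat s s" using E by (simp add: F_def minus_carrier_mat)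
  have "q = entry_norm (E - 1\<^sub>m s)"
    using E by (auto simp: q_def F_def entry_norm_def norm_minus_commute intro!: sum.cong)
  then have q: "0 \<le> q" "q < 1" using near by (auto simp: q_def entry_norm_nonneg)
  define Z :: "nat \<Rightarrow> 'a mat" where "Z = rec_nat (0\<^sub>m s s) (\<lambda>_ Y. 1\<^sub>m s + F * Y)"
  have Z0: "Z 0 = 0\<^sub>m s s" and ZS: "Z (Suc n) = 1\<^sub>m s + F * Z n" for n by (simp_all add: Z_def)
  have Z: "Z n \<in> carrier_mat s s" for n
    by (induction n) (use F in \<open>auto simp: Z0 ZS\<close>)
  have diff: "entry_norm (Z (Suc n) - Z n) \<le> q ^ n * entry_norm (1\<^sub>m s :: 'a mat)" for n
  proof (induction n)
    case 0
    have "Z (Suc 0) - Z 0 = 1\<^sub>m s" using F by (intro eq_matI) (auto simp: Z0 ZS)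
    then show ?case by simp
  next
    case (Suc n)
    have "Z (Suc (Suc n)) - Z (Suc n) = F * Z (Suc n) - F * Z n"
      unfolding ZS[of "Suc n"] ZS[of n] using F Z[of n] by (intro eq_matI) auto
    also have "\<dots> = F * (Z (Suc n) - Z n)"
      by (rule mult_minus_distrib_mat[OF F Z Z, symmetric])
    finally have "entry_norm (Z (Suc (Suc n)) - Z (Suc n)) \<le> q * entry_norm (Z (Suc n) - Z n)"
      using entry_norm_mult[OF F minus_carrier_mat[OF Z]] by (simp add: q_def)
    also have "\<dots> \<le> q * (q ^ n * entry_norm (1\<^sub>m s :: 'a mat))"
      using Suc q by (intro mult_left_mono) auto
    finally show ?case by (simp add: mult.assoc)
  qed
  have "convergent (\<lambda>n. Z n $$ (i, j))" if ij: "i < s" "j < s" for i j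
  proof -
    have le: "norm (Z (Suc n) $$ (i, j) - Z n $$ (i, j)) \<le> entry_norm (1\<^sub>m s :: 'a mat) * q ^ n" for n
      using norm_entry_le_entry_norm[of i "Z (Suc n) - Z n" j] diff[of n] ij Z[of n] Z[of "Suc n"]
      by (simp add: mult.commute)
    have sum: "summable (\<lambda>n. entry_norm (1\<^sub>m s :: 'a mat) * q ^ n)"
      using q by (intro summable_mult summable_geometric) simp
    have "summable (\<lambda>n. Z (Suc n) $$ (i, j) - Z n $$ (i, j))"
      by (rule summable_comparison_test[OF _ sum]) (intro exI allI impI le)
    then have "convergent (\<lambda>n. \<Sum>k<n. Z (Suc k) $$ (i, j) - Z k $$ (i, j))"
      by (simp add: summable_iff_convergent)
    moreover have "(\<Sum>k<n. Z (Suc k) $$ (i, j) - Z k $$ (i, j)) = Z n $$ (i, j)" for n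
      using ij by (simp add: sum_lessThan_telescope[of "\<lambda>k. Z k $$ (i, j)"] Z0)
    ultimately show ?thesis by simp
  qed
  then obtain L where L: "(\<lambda>n. Z n $$ (i, j)) \<longlonglongrightarrow> L i j" if "i < s" "j < s" for i j
    unfolding convergent_def by metis
  define Y where "Y = mat s s (\<lambda>(i, j). L i j)"
  have Y: "Y \<in> carrier_mat s s" by (simp add: Y_def)
  have "1\<^sub>m s + F * Y = Y"
  proof (rule eq_matI)
    fix i j assume "i < dim_row Y" "j < dim_col Y"
    then have ij: "i < s" "j < s" using Y by auto
    have "Z (Suc n) $$ (i, j) = 1\<^sub>m s $$ (i, j) + (\<Sum>k<s. F $$ (i, k) * Z n $$ (k, j))" for n
      using ij F Z[of n] by (simp add: ZS scalar_prod_def lessThan_atLeast0)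
    moreover have "(\<lambda>n. 1\<^sub>m s $$ (i, j) + (\<Sum>k<s. F $$ (i, k) * Z n $$ (k, j))) \<longlonglongrightarrow>
        1\<^sub>m s $$ (i, j) + (\<Sum>k<s. F $$ (i, k) * L k j)"
      using ij by (intro tendsto_intros L) auto
    ultimately have "(\<lambda>n. Z (Suc n) $$ (i, j)) \<longlonglongrightarrow> 1\<^sub>m s $$ (i, j) + (\<Sum>k<s. F $$ (i, k) * L k j)"
      by simp
    then have "L i j = 1\<^sub>m s $$ (i, j) + (\<Sum>k<s. F $$ (i, k) * L k j)"
      using LIMSEQ_unique[OF LIMSEQ_Suc[OF L[OF ij]]] by blast
    then show "(1\<^sub>m s + F * Y) $$ (i, j) = Y $$ (i, j)"
      using ij F by (simp add: Y_def scalar_prod_def lessThan_atLeast0)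
  qed (use F Y in auto)
  moreover have "F * Y = Y - E * Y"
    unfolding F_def using minus_mult_distrib_mat[OF one_carrier_mat E Y] Y by simp
  ultimately have eq: "1\<^sub>m s + (Y - E * Y) = Y" by simp
  have "E * Y = 1\<^sub>m s"
  proof (rule eq_matI)
    fix i j assume ij: "i < dim_row (1\<^sub>m s :: 'a mat)" "j < dim_col (1\<^sub>m s :: 'a mat)"
    have "(1\<^sub>m s + (Y - E * Y)) $$ (i, j) = Y $$ (i, j)" by (simp only: eq)
    moreover have "(1\<^sub>m s + (Y - E * Y)) $$ (i, j) = 1\<^sub>m s $$ (i, j) + (Y $$ (i, j) - (E * Y) $$ (i, j))"
      using ij E Y by (simp del: index_mult_mat(1))
    ultimately show "(E * Y) $$ (i, j) = 1\<^sub>m s $$ (i, j)" by (simp add: algebra_simps)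
  qed (use E Y in auto)
  then show thesis using that Y by blast
qed

lemma cls_one_mat: "cls (1\<^sub>m n) = n \<odot> cls (1\<^sub>m 1 :: 'a::unital_cstar_algebra mat)"
proof (induction n)
  case 0
  have "1\<^sub>m 0 = (0\<^sub>m 0 0 :: 'a mat)" by (intro eq_matI) auto
  then show ?case by (simp add: cls_zero)
next
  case (Suc n)
  have "1\<^sub>m (Suc n) = block_diag (1\<^sub>m n) (1\<^sub>m 1 :: 'a mat)" by (simp add: block_diag_def)
  then show ?case using Suc by (simp add: cls_block_diag)
qed

lemma cls_surj: "\<exists>A. v = cls A"
  by (induction v rule: cuntz.abs_induct) blast

lemma cuntz_order_unit: "\<exists>r. v \<le> r \<odot> cls (1\<^sub>m 1 :: 'a::unital_cstar_algebra mat)"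
proof -
  obtain A :: "'a mat" where A: "v = cls A" using cls_surj by blast
  have "A * 1\<^sub>m (dim_col A) * 1\<^sub>m (dim_col A) = A" by simp
  then have "cuntz_le A (1\<^sub>m (dim_col A))"
    using cuntz_le_factor[of A "dim_row A" "1\<^sub>m (dim_col A)" "1\<^sub>m (dim_col A)" "dim_col A"] by simp
  then have "v \<le> dim_col A \<odot> cls (1\<^sub>m 1)"
    by (simp only: A cls_le_iff flip: cls_one_mat)
  then show ?thesis by blast
qed

text \<open>An approximation with error below 1 has a right inverse, which is absorbed into
  \<open>D\<close>. The approximate relation becomes an algebraic identity.\<close>

lemma exact_factorization_of_one:
  fixes B :: "'a::unital_cstar_algebra mat"
  assumes "cuntz_le (1\<^sub>m s) B"
  obtains C D where "C \<in> carrier_mat s (dim_row B)" "D \<in> carrier_mat (dim_col B) s" "C * B * D = 1\<^sub>m s"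
proof -
  obtain C D where C: "C \<in> carrier_mat s (dim_row B)" and D: "D \<in> carrier_mat (dim_col B) s"
      and near: "entry_norm (C * B * D - 1\<^sub>m s) < 1"
    using assms[unfolded cuntz_le_iff, rule_format, of 1] by auto
  have CB: "C * B \<in> carrier_mat s (dim_col B)" using C by auto
  obtain Z where Z: "Z \<in> carrier_mat s s" "C * B * D * Z = 1\<^sub>m s"
    using right_inverse_near_one_mat[OF mult_carrier_mat[OF CB D] near] .
  have "C * B * (D * Z) = 1\<^sub>m s"
    using assoc_mult_mat[OF CB D Z(1)] Z(2) by simp
  then show thesis using that[OF C mult_carrier_mat[OF D Z(1)]] by blast
qed

text \<open>If the identity of size \<open>s\<close> factors through size \<open>r < s\<close>,
  padding both factors with zeros gives square matrices with \<open>C' * D' = 1\<close>. But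
  \<open>D' * C'\<close> has a zero at position \<open>(r, r)\<close>.\<close>

lemma stably_finite_unit_multiples:
  assumes sf: "stably_finite TYPE('a::unital_cstar_algebra)"
    and le: "s \<odot> cls (1\<^sub>m 1 :: 'a mat) \<le> r \<odot> cls (1\<^sub>m 1)"
  shows "s \<le> r"
proof (rule ccontr)
  assume "\<not> s \<le> r"
  then have rs: "r < s" by simp
  have "cuntz_le (1\<^sub>m s) (1\<^sub>m r :: 'a mat)"
    using le by (simp only: flip: cls_one_mat cls_le_iff)
  then obtain C D where C: "C \<in> carrier_mat s r" and D: "D \<in> carrier_mat r s"
      and CD: "C * 1\<^sub>m r * D = (1\<^sub>m s :: 'a mat)"
    by (rule exact_factorization_of_one) auto
  define C' D' where "C' = mat s s (\<lambda>(i, j). if j < r then C $$ (i, j) else 0)"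
    and "D' = mat s s (\<lambda>(i, j). if i < r then D $$ (i, j) else 0)"
  have C'D': "C' * D' = 1\<^sub>m s"
  proof (rule eq_matI)
    fix i j assume "i < dim_row (1\<^sub>m s :: 'a mat)" "j < dim_col (1\<^sub>m s :: 'a mat)"
    then have ij: "i < s" "j < s" by auto
    have "(C' * D') $$ (i, j) = (\<Sum>k<r + (s - r). C' $$ (i, k) * D' $$ (k, j))"
      using ij rs by (simp add: C'_def D'_def scalar_prod_def lessThan_atLeast0)
    also have "\<dots> = (\<Sum>k<r. C $$ (i, k) * D $$ (k, j))"
      unfolding sum_lessThan_add using ij rs by (simp add: C'_def D'_def)
    also have "\<dots> = (C * 1\<^sub>m r * D) $$ (i, j)"
      using ij C D by (simp add: scalar_prod_def lessThan_atLeast0)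
    finally show "(C' * D') $$ (i, j) = 1\<^sub>m s $$ (i, j)" by (simp only: CD)
  qed (simp_all add: C'_def D'_def)
  moreover have "C' \<in> carrier_mat s s" "D' \<in> carrier_mat s s" by (simp_all add: C'_def D'_def)
  ultimately have "D' * C' = 1\<^sub>m s" using sf rs unfolding stably_finite_def by auto
  then have "(D' * C') $$ (r, r) = 1\<^sub>m s $$ (r, r)" by simp
  moreover have "(D' * C') $$ (r, r) = 0"
    using rs by (simp add: C'_def D'_def scalar_prod_def)
  ultimately show False using rs by simp
qed

section \<open>Simplicity: multiples of a nonzero class dominate the unit\<close>

definition scalar_mat :: "'a \<Rightarrow> 'a mat" where
  "scalar_mat a = mat 1 1 (\<lambda>_. a)"

lemma scalar_mat_carrier [simp]:
  "scalar_mat a \<in> carrier_mat 1 1" "scalar_mat a \<in> carrier_mat (Suc 0) (Suc 0)"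
  by (simp_all add: scalar_mat_def)

lemma dim_scalar_mat [simp]: "dim_row (scalar_mat a) = 1" "dim_col (scalar_mat a) = 1"
  by (simp_all add: scalar_mat_def)

lemma scalar_mat_mult: "scalar_mat a * scalar_mat b = scalar_mat (a * b)" for a b :: "'a::semiring_0"
  by (intro eq_matI) (auto simp: scalar_mat_def scalar_prod_def)

lemma cls_scalar_mult_le:
  fixes a b :: "'a::unital_cstar_algebra"
  shows "cls (scalar_mat (a * b)) \<le> cls (scalar_mat a)" "cls (scalar_mat (a * b)) \<le> cls (scalar_mat b)"
proof -
  have "scalar_mat 1 * scalar_mat a * scalar_mat b = scalar_mat (a * b)"
    "scalar_mat a * scalar_mat b * scalar_mat 1 = scalar_mat (a * b)"
    by (simp_all add: scalar_mat_mult)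
  then show "cls (scalar_mat (a * b)) \<le> cls (scalar_mat a)" "cls (scalar_mat (a * b)) \<le> cls (scalar_mat b)"
    using cuntz_le_factor[of "scalar_mat 1" 1 "scalar_mat a" "scalar_mat b" 1]
      cuntz_le_factor[of "scalar_mat a" 1 "scalar_mat b" "scalar_mat 1" 1]
    by (simp_all add: cls_le_iff)
qed

text \<open>The diagonal matrix is compressed by a row and a column of ones.\<close>

lemma cls_scalar_add_le:
  fixes a b :: "'a::unital_cstar_algebra"
  shows "cls (scalar_mat (a + b)) \<le> cls (scalar_mat a) + cls (scalar_mat b)"
proof -
  let ?B = "block_diag (scalar_mat a) (scalar_mat b)"
  have "mat 1 2 (\<lambda>_. 1) * ?B * mat 2 1 (\<lambda>_. 1) = scalar_mat (a + b)"
    by (intro eq_matI)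
       (auto simp: scalar_mat_def block_diag_def scalar_prod_def numeral_2_eq_2)
  then have "cuntz_le (scalar_mat (a + b)) ?B"
    using cuntz_le_factor[of "mat 1 2 (\<lambda>_. 1)" 1 ?B "mat 2 1 (\<lambda>_. 1)" 1] by (simp add: numeral_2_eq_2)
  then show ?thesis by (simp add: cls_le_iff flip: cls_block_diag)
qed

lemma cls_entry_le:
  fixes A :: "'a::unital_cstar_algebra mat"
  assumes ij: "i < dim_row A" "j < dim_col A"
  shows "cls (scalar_mat (A $$ (i, j))) \<le> cls A"
proof -
  define C :: "'a mat" where "C = mat 1 (dim_row A) (\<lambda>(_, k). if k = i then 1 else 0)"
  define D :: "'a mat" where "D = mat (dim_col A) 1 (\<lambda>(k, _). if k = j then 1 else 0)"
  have CA: "(C * A) $$ (0, k) = A $$ (i, k)" if "k < dim_col A" for k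
  proof -
    have "(C * A) $$ (0, k) = (\<Sum>l<dim_row A. C $$ (0, l) * A $$ (l, k))"
      using that by (simp add: C_def scalar_prod_def lessThan_atLeast0)
    also have "\<dots> = (\<Sum>l<dim_row A. if l = i then A $$ (i, k) else 0)"
      by (intro sum.cong) (auto simp: C_def)
    finally show ?thesis using ij by simp
  qed
  have "(C * A * D) $$ (0, 0) = (\<Sum>k<dim_col A. (C * A) $$ (0, k) * D $$ (k, 0))"
    by (simp add: C_def D_def scalar_prod_def lessThan_atLeast0)
  also have "\<dots> = (\<Sum>k<dim_col A. if k = j then A $$ (i, j) else 0)"
    by (intro sum.cong) (auto simp: D_def CA)
  finally have "(C * A * D) $$ (0, 0) = A $$ (i, j)" using ij by simp
  then have "C * A * D = scalar_mat (A $$ (i, j))"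
    by (intro eq_matI) (auto simp: scalar_mat_def C_def D_def simp del: index_mult_mat(1))
  then show ?thesis
    using cuntz_le_factor[of C 1 A D 1] by (simp add: cls_le_iff C_def D_def)
qed

text \<open>The elements below some multiple of \<open>e\<close> form a two-sided ideal
  \<open>J\<close>. Simplicity concerns closed ideals, so it is applied to the closure
  \<open>I\<close>; it puts 1 in \<open>I\<close>, hence an element of \<open>J\<close> within
  distance 1 of 1. That element has a right inverse, so its class dominates that of 1.\<close>

lemma simple_unit_le_multiple_scalar:
  fixes e :: "'a::unital_cstar_algebra"
  assumes simple: "simple_cstar_algebra TYPE('a)" and e: "e \<noteq> 0"
  obtains n where "cls (1\<^sub>m 1 :: 'a mat) \<le> n \<odot> cls (scalar_mat e)"
proof -
  define J where "J = {a. \<exists>n. cls (scalar_mat a) \<le> n \<odot> cls (scalar_mat e)}"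
  define I where "I = {a. \<forall>d>0. \<exists>b\<in>J. dist b a < d}"
  have JI: "J \<subseteq> I"
  proof
    fix a assume "a \<in> J"
    moreover have "dist a a < d" if "0 < d" for d using that by simp
    ultimately show "a \<in> I" unfolding I_def by blast
  qed
  have "cls (scalar_mat e) \<le> 1 \<odot> cls (scalar_mat e)" by simp
  then have eJ: "e \<in> J" unfolding J_def by blast
  have "scalar_mat (0 :: 'a) = 0\<^sub>m 1 1" by (intro eq_matI) (auto simp: scalar_mat_def)
  then have "cls (scalar_mat (0 :: 'a)) \<le> 0 \<odot> cls (scalar_mat e)" by (simp add: cls_zero)
  then have zJ: "0 \<in> J" unfolding J_def by blast
  have addJ: "a + b \<in> J" if "a \<in> J" "b \<in> J" for a b
  proof -
    obtain m n where "cls (scalar_mat a) \<le> m \<odot> cls (scalar_mat e)" "cls (scalar_mat b) \<le> n \<odot> cls (scalar_mat e)"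
      using \<open>a \<in> J\<close> \<open>b \<in> J\<close> by (auto simp: J_def)
    then have "cls (scalar_mat (a + b)) \<le> (m + n) \<odot> cls (scalar_mat e)"
      using order_trans[OF cls_scalar_add_le add_mono] by (simp add: multiple_add_left)
    then show ?thesis unfolding J_def by blast
  qed
  have multJ: "a * b \<in> J" "b * a \<in> J" if "b \<in> J" for a b
    using that cls_scalar_mult_le[of a b] cls_scalar_mult_le[of b a] order_trans unfolding J_def by blast+
  have "closed I"
    unfolding closed_def open_dist
  proof (intro ballI)
    fix a assume "a \<in> - I"
    then obtain d where d: "0 < d" "\<And>b. b \<in> J \<Longrightarrow> d \<le> dist b a" by (auto simp: I_def not_less)
    have "a' \<in> - I" if "dist a' a < d / 2" for a'
    proof -
      have "d / 2 \<le> dist b a'" if "b \<in> J" for b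
        using d(2)[OF that] dist_triangle[of b a a'] \<open>dist a' a < d / 2\<close> by linarith
      then show ?thesis using d(1) by (auto simp: I_def not_less intro!: exI[of _ "d / 2"])
    qed
    then show "\<exists>d>0. \<forall>a'. dist a' a < d \<longrightarrow> a' \<in> - I" using d(1) half_gt_zero by blast
  qed
  moreover have "a + b \<in> I" if ab: "a \<in> I" "b \<in> I" for a b
    unfolding I_def
  proof (intro CollectI allI impI)
    fix d :: real assume "0 < d"
    then have "0 < d / 2" by simp
    then obtain a' b' where "a' \<in> J" "b' \<in> J" "dist a' a < d / 2" "dist b' b < d / 2"
      using ab unfolding I_def by blast
    moreover have "dist (a' + b') (a + b) \<le> dist a' a + dist b' b" unfolding dist_norm by (rule norm_diff_triangle_ineq)
    ultimately show "\<exists>c\<in>J. dist c (a + b) < d" using addJ by (intro bexI[of _ "a' + b'"]) auto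
  qed
  moreover have "a * b \<in> I \<and> b * a \<in> I" if b: "b \<in> I" for a b
  proof -
    have "\<exists>c\<in>J. dist (a * c) (a * b) < d \<and> dist (c * a) (b * a) < d" if "0 < d" for d
    proof -
      have "0 < d / (norm a + 1)" using that by (simp add: add_nonneg_pos)
      then obtain c where c: "c \<in> J" "norm (c - b) < d / (norm a + 1)"
        using b unfolding I_def dist_norm by blast
      have "norm a * norm (c - b) \<le> (norm a + 1) * norm (c - b)" by (simp add: mult_right_mono)
      also have "\<dots> < d" using c(2) by (simp add: pos_less_divide_eq add_nonneg_pos mult.commute)
      finally have "norm a * norm (c - b) < d" .
      then show ?thesis
        using norm_mult_ineq[of a "c - b"] norm_mult_ineq[of "c - b" a] c(1)
        by (intro bexI[of _ c]) (auto simp: dist_norm mult.commute simp flip: right_diff_distrib left_diff_distrib)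
    qed
    then show ?thesis using multJ unfolding I_def by blast
  qed
  moreover have "0 \<in> I" using zJ JI by blast
  ultimately have "closed_two_sided_ideal I"
    unfolding closed_two_sided_ideal_def by simp
  then have "I = UNIV" using simple e eJ JI unfolding simple_cstar_algebra_def by blast
  then have "1 \<in> I" by simp
  then have "\<exists>a\<in>J. dist a 1 < 1" unfolding I_def mem_Collect_eq by (rule allE[of _ 1]) simp
  then obtain a where a: "a \<in> J" "dist a 1 < 1" by blast
  have "entry_norm (scalar_mat a - 1\<^sub>m 1) < 1"
    using a(2) by (simp add: entry_norm_def scalar_mat_def dist_norm)
  then obtain Z where Z: "Z \<in> carrier_mat 1 1" "scalar_mat a * Z = 1\<^sub>m 1"
    using right_inverse_near_one_mat[OF scalar_mat_carrier(1)] by metis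
  have "1\<^sub>m 1 * scalar_mat a * Z = 1\<^sub>m 1" using Z(2) by simp
  then have "cls (1\<^sub>m 1 :: 'a mat) \<le> cls (scalar_mat a)"
    using cuntz_le_factor[of "1\<^sub>m 1" 1 "scalar_mat a" Z 1] Z(1) by (simp add: cls_le_iff)
  then show thesis using a(1) that order_trans unfolding J_def by blast
qed

lemma monoid_with_unit_cuntz:
  fixes x :: "'a::unital_cstar_algebra mat"
  assumes "stably_finite TYPE('a)" "simple_cstar_algebra TYPE('a)"
    and nz: "x \<noteq> 0\<^sub>m (dim_row x) (dim_col x)"
  shows "monoid_with_unit (cls (1\<^sub>m 1 :: 'a mat)) (cls x)"
proof
  obtain i j where ij: "i < dim_row x" "j < dim_col x" "x $$ (i, j) \<noteq> 0"
    using nz by (metis eq_matI index_zero_mat)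
  obtain n where "cls (1\<^sub>m 1 :: 'a mat) \<le> n \<odot> cls (scalar_mat (x $$ (i, j)))"
    using simple_unit_le_multiple_scalar[OF assms(2) ij(3)] .
  then have "cls (1\<^sub>m 1 :: 'a mat) \<le> n \<odot> cls x"
    using order_trans multiple_mono[OF cls_entry_le[OF ij(1,2)]] by blast
  then show "\<exists>n. cls (1\<^sub>m 1 :: 'a mat) \<le> n \<odot> cls x" by blast
qed (rule cuntz_nonneg cuntz_order_unit stably_finite_unit_multiples[OF assms(1)]; assumption?)+


section \<open>Dimension functions as states\<close>

lemma cuntz_class_eq: "A \<in> rect_mats \<Longrightarrow> cuntz_class A = {B \<in> rect_mats. cls B = cls A}"
  by (auto simp: cuntz_class_def cuntz_rel_def cls_eq_iff)

text \<open>A concrete representative of a multiple. It starts from the \<open>1 \<times> 1\<close>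
  zero matrix so as to stay inside \<open>rect_mats\<close>.\<close>

primrec block_power :: "nat \<Rightarrow> 'a::zero mat \<Rightarrow> 'a mat" where
  "block_power 0 A = 0\<^sub>m 1 1"
| "block_power (Suc n) A = block_diag (block_power n A) A"

lemma block_diag_rect: "A \<in> rect_mats \<Longrightarrow> B \<in> rect_mats \<Longrightarrow> block_diag A B \<in> rect_mats"
  by (auto simp: rect_mats_def)

lemma block_power_rect: "A \<in> rect_mats \<Longrightarrow> block_power n A \<in> rect_mats"
  by (induction n) (simp_all add: block_diag_rect, simp add: rect_mats_def)

lemma cls_block_power: "cls (block_power n A) = n \<odot> cls A"
  by (induction n) (simp_all add: cls_zero cls_block_diag)

text \<open>The union in \<open>cuntz_plus\<close> runs over all representatives, but every pair
  yields the same class. \<open>block_power\<close> shows that there is a pair at all.\<close>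

lemma cuntz_multiple_eq:
  assumes A: "A \<in> rect_mats"
  shows "cuntz_multiple n (cuntz_class A) = {B \<in> rect_mats. cls B = n \<odot> cls A}"
proof (induction n)
  case 0
  have "0\<^sub>m 1 1 \<in> rect_mats" by (simp add: rect_mats_def)
  from cuntz_class_eq[OF this] show ?case by (simp add: cls_zero)
next
  case (Suc n)
  have "cuntz_class (block_diag B C) = {D \<in> rect_mats. cls D = Suc n \<odot> cls A}"
    if "B \<in> cuntz_multiple n (cuntz_class A)" "C \<in> cuntz_class A" for B C
    using that A unfolding Suc by (simp add: cuntz_class_eq block_diag_rect cls_block_diag)
  moreover have "block_power n A \<in> cuntz_multiple n (cuntz_class A)" "A \<in> cuntz_class A"
    using A unfolding Suc by (simp_all add: block_power_rect cls_block_power cuntz_class_eq)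
  ultimately show ?case by (auto simp: cuntz_plus_def)
qed

lemma cuntz_class_le_multiple_iff:
  assumes "A \<in> rect_mats" "B \<in> rect_mats"
  shows "cuntz_class_le (cuntz_multiple m (cuntz_class A)) (cuntz_multiple n (cuntz_class B)) \<longleftrightarrow>
    m \<odot> cls A \<le> n \<odot> cls B"
  unfolding cuntz_class_le_def cuntz_multiple_eq[OF assms(1)] cuntz_multiple_eq[OF assms(2)]
proof
  assume "m \<odot> cls A \<le> n \<odot> cls B"
  then have "cuntz_le (block_power m A) (block_power n B)"
    by (simp add: cls_block_power flip: cls_le_iff)
  then show "\<exists>C\<in>{C \<in> rect_mats. cls C = m \<odot> cls A}. \<exists>D\<in>{D \<in> rect_mats. cls D = n \<odot> cls B}. cuntz_le C D"
    using assms block_power_rect cls_block_power by blast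
qed (auto simp flip: cls_le_iff)

lemma one_mat_rect: "1\<^sub>m 1 \<in> rect_mats"
  by (simp add: rect_mats_def)

lemma dimension_function_block_power:
  assumes "dimension_function \<phi>" "A \<in> rect_mats"
  shows "\<phi> (block_power n A) = real n * \<phi> A"
proof (induction n)
  case 0
  let ?Z = "0\<^sub>m 1 1 :: 'a mat"
  have Z: "?Z \<in> rect_mats" by (simp add: rect_mats_def)
  \<comment> \<open>The zero matrix is equivalent to its own double, so additivity forces the value
    0.\<close>
  have "cls (block_diag ?Z ?Z) = cls ?Z" by (simp add: cls_block_diag cls_zero)
  then have "\<phi> (block_diag ?Z ?Z) = \<phi> ?Z"
    using assms(1) Z block_diag_rect[OF Z Z] unfolding dimension_function_def cls_eq_iff
    by (meson order_antisym)
  moreover have "\<phi> (block_diag ?Z ?Z) = \<phi> ?Z + \<phi> ?Z"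
    using assms(1) Z unfolding dimension_function_def by blast
  ultimately show ?case by simp
next
  case (Suc n)
  have "\<phi> (block_diag (block_power n A) A) = \<phi> (block_power n A) + \<phi> A"
    using assms block_power_rect unfolding dimension_function_def by blast
  then show ?case using Suc by (simp add: algebra_simps)
qed

lemma dimension_function_le:
  assumes "dimension_function \<phi>" "A \<in> rect_mats" "B \<in> rect_mats" "m \<odot> cls A \<le> n \<odot> cls B"
  shows "real m * \<phi> A \<le> real n * \<phi> B"
proof -
  have "cuntz_le (block_power m A) (block_power n B)"
    using assms(4) by (simp add: cls_block_power flip: cls_le_iff)
  then have "\<phi> (block_power m A) \<le> \<phi> (block_power n B)"
    using assms block_power_rect unfolding dimension_function_def by blast
  then show ?thesis by (simp add: dimension_function_block_power assms)
qed

theorem mainTheorem12: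
  fixes x :: "'a::unital_cstar_algebra mat"
  assumes "stably_finite TYPE('a)"
    and "simple_cstar_algebra TYPE('a)"
    and "x \<in> rect_mats"
    and "x \<noteq> 0\<^sub>m (dim_row x) (dim_col x)"
  shows "convergent (\<lambda>n. real (lower_count n x) / real n) \<and>
         convergent (\<lambda>n. real (upper_count n x) / real n) \<and>
         {A_minus x .. A_plus x} = {\<phi> x | \<phi>. dimension_function \<phi>}"
proof -
  let ?u = "cls (1\<^sub>m 1 :: 'a mat)"
  interpret monoid_with_unit ?u "cls x"
    by (rule monoid_with_unit_cuntz[OF assms(1,2,4)])
  have lower_eq: "lower_count n x = lower n" for n
    unfolding lower_count_def lower_def cuntz_class_le_multiple_iff[OF one_mat_rect assms(3)] ..
  have upper_eq: "upper_count n x = upper n" for n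
    unfolding upper_count_def upper_def cuntz_class_le_multiple_iff[OF assms(3) one_mat_rect] ..
  obtain L where L: "(\<lambda>n. real (lower n) / real n) \<longlonglongrightarrow> L" "0 \<le> L" "\<And>n. real (lower n) \<le> L * real n"
    by (rule lower_limit) blast
  obtain U where U: "(\<lambda>n. real (upper n) / real n) \<longlonglongrightarrow> U" "\<And>n. 1 \<le> n \<Longrightarrow> U * real n \<le> real (upper n)"
    by (rule upper_limit) blast
  have A: "A_minus x = L" "A_plus x = U"
    using L(1) U(1) unfolding A_minus_def A_plus_def lower_eq upper_eq by (simp_all add: limI)
  have "\<exists>\<phi>. dimension_function \<phi> \<and> \<phi> x = \<alpha>" if \<alpha>: "L \<le> \<alpha>" "\<alpha> \<le> U" for \<alpha>
  proof -
    interpret monoid_with_value ?u "cls x" \<alpha>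
    proof
      show "0 \<le> \<alpha>" using L(2) \<alpha>(1) by simp
      show "real (lower n) \<le> \<alpha> * real n" for n
        using L(3)[of n] mult_right_mono[OF \<alpha>(1), of "real n"] by simp
      show "\<alpha> * real n \<le> real (upper n)" if "1 \<le> n" for n
        using U(2)[OF that] mult_right_mono[OF \<alpha>(2), of "real n"] by simp
    qed
    obtain f where f: "\<And>v. 0 \<le> f v" "\<And>v w. v \<le> w \<Longrightarrow> f v \<le> f w"
        "\<And>v w. f (v + w) = f v + f w" "f ?u = 1" "f (cls x) = \<alpha>"
      by (rule exists_state_with_value) blast
    \<comment> \<open>A state composed with \<open>cls\<close> is a dimension function, since
      \<open>cls\<close> turns block sums into sums and \<open>cuntz_le\<close> into the
      order.\<close>
    have "dimension_function (\<lambda>A. f (cls A))"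
      unfolding dimension_function_def using f by (simp add: cls_block_diag flip: cls_le_iff)
    then show ?thesis using f(5) by blast
  qed
  moreover have "L \<le> \<phi> x \<and> \<phi> x \<le> U" if \<phi>: "dimension_function \<phi>" for \<phi>
  proof -
    have one: "\<phi> (1\<^sub>m 1) = 1" using \<phi> by (simp add: dimension_function_def)
    \<comment> \<open>\<open>le_lower_iff\<close> at \<open>s = lower n\<close> says that the
      supremum is attained, so the dimension function can be applied to that very
      inequality.\<close>
    have lo: "real (lower n) \<le> real n * \<phi> x" for n
      using dimension_function_le[OF \<phi> one_mat_rect assms(3) iffD1[OF le_lower_iff order_refl], of n]
      unfolding one by simp
    have up: "real n * \<phi> x \<le> real (upper n)" for n
      using dimension_function_le[OF \<phi> assms(3) one_mat_rect upper_mem(2), of n] unfolding one by simp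
    have "L \<le> \<phi> x"
      \<comment> \<open>The witness 1 restricts to indices where division by \<open>n\<close> is
        harmless.\<close>
      by (rule LIMSEQ_le_const2[OF L(1)]) (use lo in \<open>auto intro!: exI[of _ 1] simp: field_simps\<close>)
    moreover have "\<phi> x \<le> U"
      by (rule LIMSEQ_le_const[OF U(1)]) (use up in \<open>auto intro!: exI[of _ 1] simp: field_simps\<close>)
    ultimately show ?thesis ..
  qed
  ultimately have "{L..U} = {\<phi> x | \<phi>. dimension_function \<phi>}" by fastforce
  then show ?thesis
    using L(1) U(1) unfolding A lower_eq upper_eq convergent_def by blast
qed

end
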